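(* Let $n\ge 5$ be an odd integer such that either $n\equiv 1\pmod 4$ or $n$ is not a prime. Let $m\ge 1$ be an odd integer and $t\ge 2$ an even integer admitting factorizations $$m=m_0\Big(\prod_{i=1}^{r_1}m_i\Big)\Big(\prod_{i=1}^{q_1}m_i'\Big),\qquad t=t_0\Big(\prod_{i=1}^{r_2}t_i\Big)\Big(\prod_{i=1}^{q_2}t_i'\Big),$$ where $r_1,q_1,r_2,q_2\ge 0$ and $m_0,t_0\ge 1$ are integers, $m_1,\ldots,m_{r_1},t_1,\ldots,t_{r_2}$ are odd primes, and $m_1',\ldots,m_{q_1}',t_1',\ldots,t_{q_2}'\ge 2$ are integers. Suppose that there exist even divisors $d_i$ of $m_i-1$ ($1\le i\le r_1$), even divisors $d_j'$ of $t_j-1$ ($1\le j\le r_2$), and $\kappa\in\{4,16\}$ such that $$\kappa\Big(\prod_{i=1}^{r_1}d_i\Big)\Big(\prod_{j=1}^{r_2}d_j'\Big)\Big(\prod_{i=1}^{q_1}(m_i'-1)\Big)\Big(\prod_{i=1}^{q_2}(t_i'-1)\Big)=mt$$ and $$t+4\Big(\prod_{i=1}^{r_1}d_i\Big)\Big(\prod_{i=1}^{q_1}(m_i'-1)\Big)\ne m+\frac{\kappa}{4}\Big(\prod_{j=1}^{r_2}d_j'\Big)\Big(\prod_{i=1}^{q_2}(t_i'-1)\Big).$$ Then there exists a nut graph with $(o_v,o_e)=(2,3)$ of order $n(m+t)$. In particular, for every odd integer $n\ge 5$ such that either $n\equiv 1\pmod 4$ or $n$ is not a prime, there exists a nut graph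 with $(o_v,o_e)=(2,3)$ of order $ns$ for each $s\in\{17,19,23,73,79,97,107,113\}$.
   Context: A nut graph is a finite simple graph whose adjacency matrix has a one-dimensional null space spanned by a vector with no zero entries. For a graph $\Gamma$, $o_v$ and $o_e$ denote the numbers of orbits of $\mathrm{Aut}(\Gamma)$ on the vertex set and on the edge set of $\Gamma$, respectively. Empty products equal $1$. *)

theory Defs
  imports
    "HOL-Computational_Algebra.Primes"
    "HOL-Algebra.Group_Action"
    "Jordan_Normal_Form.Matrix_Kernel"
begin

definition simple_graph :: "'a set \<Rightarrow> 'a set set \<Rightarrow> bool" where
  "simple_graph V E \<longleftrightarrow> finite V \<and> (\<forall>e\<in>E. e \<subseteq> V \<and> card e = 2)"

text \<open>The rows and columns are indexed by a list \<open>vs\<close> enumerating the vertices. A different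
  enumeration permutes rows and columns simultaneously, so the properties of the null space used
  below do not depend on it.\<close>

definition adjacency_matrix :: "'a list \<Rightarrow> 'a set set \<Rightarrow> real mat" where
  "adjacency_matrix vs E =
     mat (length vs) (length vs) (\<lambda>(i, j). if {vs ! i, vs ! j} \<in> E then 1 else 0)"

definition nut_graph :: "'a set \<Rightarrow> 'a set set \<Rightarrow> bool" where
  "nut_graph V E \<longleftrightarrow> simple_graph V E \<and>
     (\<exists>vs. distinct vs \<and> set vs = V \<and>
        kernel_dim (adjacency_matrix vs E) = 1 \<and>
        (\<exists>x \<in> carrier_vec (card V). (\<forall>i<card V. x $ i \<noteq> 0) \<and>
           mat_kernel (adjacency_matrix vs E) = {c \<cdot>\<^sub>v x | c. True}))"

definition aut_group :: "'a set \<Rightarrow> 'a set set \<Rightarrow> ('a \<Rightarrow> 'a) monoid" where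
  "aut_group V E = BijGroup V
     \<lparr>carrier := {f \<in> Bij V. \<forall>u\<in>V. \<forall>v\<in>V. {f u, f v} \<in> E \<longleftrightarrow> {u, v} \<in> E}\<rparr>"

definition num_vertex_orbits :: "'a set \<Rightarrow> 'a set set \<Rightarrow> nat" where
  "num_vertex_orbits V E = card (orbits (aut_group V E) V (\<lambda>f v. f v))"

definition num_edge_orbits :: "'a set \<Rightarrow> 'a set set \<Rightarrow> nat" where
  "num_edge_orbits V E = card (orbits (aut_group V E) E (\<lambda>f e. f ` e))"

end

theory Submission
  imports Defs "HOL-Combinatorics.Transposition" "HOL-Number_Theory.Residue_Primitive_Roots"
begin

text \<open>
  The graph is glued from small symmetric pieces. Let \<open>N\<close>, \<open>M\<close>, \<open>T\<close> be sets of sizes \<open>n\<close>, \<open>m\<close>,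
  \<open>t\<close>, with \<open>M\<close> and \<open>T\<close> disjoint, and let \<open>N \<times> (M \<union> T)\<close> be the vertex set. Above each
  \<open>x \<in> N\<close> every vertex of \<open>{x} \<times> M\<close> is joined to every vertex of \<open>{x} \<times> T\<close>. Inside \<open>N \<times> M\<close>
  the graph is the tensor product of a graph \<open>B\<close> on \<open>N\<close> and a graph \<open>C\<close> on \<open>M\<close>; inside \<open>N \<times> T\<close> it
  is the tensor product of \<open>B'\<close> and \<open>C'\<close>, where \<open>B' = B\<close> if \<open>\<kappa> = 16\<close> and \<open>B'\<close> is the identity
  relation if \<open>\<kappa> = 4\<close>. All factors are regular, arc-transitive and have an invertible adjacency
  matrix; these properties survive tensor products. The degree of \<open>B\<close> is 4, so that of \<open>B'\<close> is
  \<open>\<kappa> div 4\<close>; \<open>d\<close> and \<open>d'\<close> denote the degrees of \<open>C\<close> and \<open>C'\<close>.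

  \<^emph>\<open>Null space.\<close> For \<open>f\<close> in the null space, let \<open>U x\<close> and \<open>W x\<close> be its sums over \<open>{x} \<times> M\<close> and
  \<open>{x} \<times> T\<close>. At a vertex \<open>(x, a)\<close> with \<open>a \<in> M\<close> the equation says that the tensor product of \<open>B\<close>
  and \<open>C\<close> maps \<open>f\<close> to \<open>- W x\<close>, independently of \<open>a\<close>. As that product is invertible, \<open>f\<close> is
  constant on \<open>{x} \<times> M\<close>, and likewise on \<open>{x} \<times> T\<close>. What remains are the equations
  \<open>d B U = - m W\<close> and \<open>d' B' W = - t U\<close>. By the product condition \<open>4 (\<kappa> div 4) d d' = m t\<close> they
  give \<open>B' B U = 4 (\<kappa> div 4) U\<close>, that is, \<open>U\<close> belongs to the largest possible eigenvalue. Since any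
  two vertices of \<open>B\<close> are joined by a walk of even length, the maximum principle makes \<open>U\<close> constant.
  So the null space is spanned by the vector that is 1 on \<open>N \<times> M\<close> and \<open>- 4 d / t\<close> on \<open>N \<times> T\<close>.
  See \<open>fibre_average\<close>, \<open>two_step_eigenfunction_constant\<close> and \<open>kernel_unique\<close>.

  \<^emph>\<open>Orbits.\<close> The inequality in the hypotheses says that vertices in the two halves have different
  degrees, so there are at least two vertex orbits and three edge orbits. Automorphisms of \<open>B\<close>, \<open>C\<close>
  and \<open>C'\<close> act simultaneously on the glued graph and show that there are no more
  (\<open>arcs_adj\<close>, \<open>num_vertex_orbits\<close>, \<open>num_edge_orbits\<close>).

  \<^emph>\<open>Factors.\<close> On a set of size \<open>k\<close> there are the identity relation (degree 1) and, for \<open>k \<ge> 2\<close>,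
  the complete graph (degree \<open>k - 1\<close>). For an odd prime \<open>p\<close> and an even divisor \<open>d\<close> of \<open>p - 1\<close>
  there is the circulant graph whose connection set is the group of \<open>d\<close>-th roots of unity modulo \<open>p\<close>
  (degree \<open>d\<close>). The factorizations of \<open>m\<close> and \<open>t\<close> translate into tensor products of these. For \<open>B\<close>
  one takes the circulant with \<open>d = 4\<close> if \<open>n\<close> is a prime congruent to 1 modulo 4, and the tensor
  product of two odd cycles if \<open>n\<close> is composite. The only deep point is that circulants of prime order
  are invertible (\<open>circulant_kernel_real\<close>): modulo \<open>p\<close> the cyclic shift is unipotent, so a circulant
  with \<open>d\<close> ones per row is \<open>d\<close> times a unipotent operator, where \<open>p\<close> does not divide \<open>d\<close>. This
  excludes integer solutions that are not divisible by \<open>p\<close>, hence all integer solutions other than 0,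
  and a rational-linear functional on the reals reduces real solutions to these.
\<close>

section \<open>Relations as graphs, their isomorphisms and neighbour sums\<close>

text \<open>Graphs are represented by a vertex set and a binary relation. Loops are admitted, because the
  identity relation is one of the tensor factors.\<close>

definition nbrs :: "'a set \<Rightarrow> ('a \<Rightarrow> 'a \<Rightarrow> bool) \<Rightarrow> 'a \<Rightarrow> 'a set" where
  "nbrs X R x = {y \<in> X. R x y}"

definition graph_iso ::
  "('a \<Rightarrow> 'b) \<Rightarrow> 'a set \<Rightarrow> ('a \<Rightarrow> 'a \<Rightarrow> bool) \<Rightarrow> 'b set \<Rightarrow> ('b \<Rightarrow> 'b \<Rightarrow> bool) \<Rightarrow> bool" where
  "graph_iso h X R Y Q \<longleftrightarrow> bij_betw h X Y \<and> (\<forall>x\<in>X. \<forall>y\<in>X. Q (h x) (h y) \<longleftrightarrow> R x y)"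

lemma graph_isoD:
  assumes "graph_iso h X R Y Q"
  shows graph_iso_bij: "bij_betw h X Y"
    and graph_iso_rel: "\<lbrakk>x \<in> X; y \<in> X\<rbrakk> \<Longrightarrow> Q (h x) (h y) \<longleftrightarrow> R x y"
    and graph_iso_mem: "x \<in> X \<Longrightarrow> h x \<in> Y"
  using assms by (auto simp: graph_iso_def dest: bij_betwE)

lemma graph_iso_comp:
  assumes "graph_iso h X R Y Q" "graph_iso k Y Q Z P"
  shows "graph_iso (k \<circ> h) X R Z P"
  using assms bij_betw_trans[of h X Y k Z] unfolding graph_iso_def
  by (auto dest: bij_betwE)

lemma graph_iso_inv:
  assumes "graph_iso h X R Y Q"
  shows "graph_iso (inv_into X h) Y Q X R"
proof -
  have bij: "bij_betw h X Y" using assms by (simp add: graph_iso_def)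
  have "R (inv_into X h u) (inv_into X h v) \<longleftrightarrow> Q u v" if "u \<in> Y" "v \<in> Y" for u v
    using assms that bij_betw_inv_into_right[OF bij] bij_betwE[OF bij_betw_inv_into[OF bij]]
    unfolding graph_iso_def by metis
  with bij show ?thesis by (simp add: graph_iso_def bij_betw_inv_into)
qed

lemma graph_iso_copy:
  assumes "bij_betw h X Y"
  shows "graph_iso h X R Y (\<lambda>u v. R (inv_into X h u) (inv_into X h v))"
  using assms by (simp add: graph_iso_def bij_betw_inv_into_left)

lemma graph_iso_id: "graph_iso (\<lambda>x. x) X R X R"
  by (simp add: graph_iso_def bij_betw_def)

lemma nbrs_graph_iso:
  assumes "graph_iso h X R Y Q" "x \<in> X"
  shows "nbrs Y Q (h x) = h ` nbrs X R x"
  using assms by (auto simp: graph_iso_def nbrs_def bij_betw_def)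

lemma nbrs_graph_iso_transport:
  assumes "graph_iso h X R Y Q" "x \<in> X"
  shows card_nbrs_graph_iso: "card (nbrs Y Q (h x)) = card (nbrs X R x)"
    and sum_nbrs_graph_iso: "sum f (nbrs Y Q (h x)) = (\<Sum>y\<in>nbrs X R x. f (h y))"
proof -
  have "inj_on h (nbrs X R x)"
    using assms by (auto simp: graph_iso_def bij_betw_def nbrs_def inj_on_def)
  then show "card (nbrs Y Q (h x)) = card (nbrs X R x)"
    "sum f (nbrs Y Q (h x)) = (\<Sum>y\<in>nbrs X R x. f (h y))"
    by (simp_all add: nbrs_graph_iso[OF assms] card_image sum.reindex)
qed

lemma nbrs_subset: "nbrs X R x \<subseteq> X"
  by (auto simp: nbrs_def)

text \<open>The properties that all pieces share and that tensor products inherit. Nonsingularity is that of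
  the adjacency operator on real functions. Vertex-transitivity follows from arc-transitivity, since
  every vertex has a neighbour.\<close>

locale tensor_factor =
  fixes X :: "'a set" and R :: "'a \<Rightarrow> 'a \<Rightarrow> bool" and d :: nat
  assumes fin: "finite X"
    and sym: "\<lbrakk>x \<in> X; y \<in> X; R x y\<rbrakk> \<Longrightarrow> R y x"
    and pos: "d > 0"
    and reg: "x \<in> X \<Longrightarrow> card (nbrs X R x) = d"
    and arc: "\<lbrakk>x \<in> X; y \<in> X; x' \<in> X; y' \<in> X; R x y; R x' y'\<rbrakk>
      \<Longrightarrow> \<exists>g. graph_iso g X R X R \<and> g x = x' \<and> g y = y'"
    and nonsingular: "\<lbrakk>\<And>x. x \<in> X \<Longrightarrow> (\<Sum>y\<in>nbrs X R x. f y) = (0::real); x \<in> X\<rbrakk> \<Longrightarrow> f x = 0"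
begin

lemma ex_nbr:
  assumes "x \<in> X"
  obtains y where "y \<in> X" "R x y"
proof -
  have "nbrs X R x \<noteq> {}" using reg[OF assms] pos by force
  then show ?thesis using that by (auto simp: nbrs_def)
qed

lemma vertex_transitive:
  assumes "x \<in> X" "x' \<in> X"
  obtains g where "graph_iso g X R X R" "g x = x'"
  using arc assms ex_nbr by metis

lemma finite_nbrs: "finite (nbrs X R x)"
  using fin by (simp add: nbrs_def)

lemma sum_sum_nbrs:
  fixes f :: "'a \<Rightarrow> real"
  shows "(\<Sum>x\<in>X. \<Sum>y\<in>nbrs X R x. f y) = real d * (\<Sum>y\<in>X. f y)"
proof -
  have "(\<Sum>x\<in>X. \<Sum>y\<in>nbrs X R x. f y) = (\<Sum>x\<in>X. \<Sum>y\<in>X. if R x y then f y else 0)"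
    by (simp add: nbrs_def sum.inter_filter fin)
  also have "\<dots> = (\<Sum>y\<in>X. \<Sum>x\<in>X. if R x y then f y else 0)" by (rule sum.swap)
  also have "\<dots> = (\<Sum>y\<in>X. \<Sum>x\<in>nbrs X R y. f y)"
  proof (rule sum.cong[OF refl])
    fix y assume "y \<in> X"
    then have "nbrs X R y = {x \<in> X. R x y}" using sym by (auto simp: nbrs_def)
    then show "(\<Sum>x\<in>X. if R x y then f y else 0) = (\<Sum>x\<in>nbrs X R y. f y)"
      by (simp only: sum.inter_filter[OF fin])
  qed
  finally show ?thesis by (simp add: reg sum_distrib_left)
qed

end

lemma tensor_factor_graph_iso:
  assumes "tensor_factor X R d" and iso: "graph_iso h X R Y Q"
  shows "tensor_factor Y Q d"
proof -
  interpret tensor_factor X R d by fact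
  note bij = graph_iso_bij[OF iso]
  define k where "k = inv_into X h"
  have k: "graph_iso k Y Q X R" unfolding k_def by (rule graph_iso_inv[OF iso])
  have hk: "h (k u) = u" if "u \<in> Y" for u
    using that bij_betw_inv_into_right[OF bij] by (simp add: k_def)
  have kh: "k (h x) = x" if "x \<in> X" for x
    using that bij_betw_inv_into_left[OF bij] by (simp add: k_def)
  note kY = graph_iso_mem[OF k]
  note kQ = graph_iso_rel[OF k]
  show ?thesis
  proof
    show "finite Y" using bij fin bij_betw_finite by blast
    show "Q y x" if "x \<in> Y" "y \<in> Y" "Q x y" for x y
      using that kQ kY sym by metis
    show "d > 0" by (rule pos)
    show "card (nbrs Y Q x) = d" if "x \<in> Y" for x
      using card_nbrs_graph_iso[OF k that] reg[OF kY[OF that]] by simp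
    show "\<exists>g. graph_iso g Y Q Y Q \<and> g x = x' \<and> g y = y'"
      if xy: "x \<in> Y" "y \<in> Y" "x' \<in> Y" "y' \<in> Y" "Q x y" "Q x' y'" for x y x' y'
    proof -
      obtain g where g: "graph_iso g X R X R" "g (k x) = k x'" "g (k y) = k y'"
        using arc[of "k x" "k y" "k x'" "k y'"] kY kQ xy by blast
      have "graph_iso (h \<circ> (g \<circ> k)) Y Q Y Q"
        by (intro graph_iso_comp[OF _ iso] graph_iso_comp[OF k g(1)])
      then show ?thesis using g hk xy by (intro exI[of _ "h \<circ> (g \<circ> k)"]) simp
    qed
    show "f x = 0" if z: "\<And>x. x \<in> Y \<Longrightarrow> (\<Sum>y\<in>nbrs Y Q x. f y) = (0::real)" and "x \<in> Y" for f x
    proof -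
      have "f (h (k x)) = 0"
      proof (rule nonsingular[of "\<lambda>u. f (h u)"])
        show "(\<Sum>y\<in>nbrs X R u. f (h y)) = 0" if "u \<in> X" for u
          using z[OF graph_iso_mem[OF iso that]] sum_nbrs_graph_iso[OF iso that, of f] by simp
      qed (use kY that in auto)
      then show ?thesis using hk that by simp
    qed
  qed
qed

definition tensor :: "('a \<Rightarrow> 'a \<Rightarrow> bool) \<Rightarrow> ('b \<Rightarrow> 'b \<Rightarrow> bool) \<Rightarrow> 'a \<times> 'b \<Rightarrow> 'a \<times> 'b \<Rightarrow> bool" where
  "tensor R Q = (\<lambda>(x, a) (y, b). R x y \<and> Q a b)"

lemma tensor_simp [simp]: "tensor R Q (x, a) (y, b) \<longleftrightarrow> R x y \<and> Q a b"
  by (simp add: tensor_def)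

lemma nbrs_tensor: "nbrs (X \<times> Y) (tensor R Q) (x, a) = nbrs X R x \<times> nbrs Y Q a"
  by (auto simp: nbrs_def)

lemma graph_iso_tensor:
  assumes "graph_iso g X R X' R'" "graph_iso h Y Q Y' Q'"
  shows "graph_iso (map_prod g h) (X \<times> Y) (tensor R Q) (X' \<times> Y') (tensor R' Q')"
  using assms bij_betw_map_prod[of g X X' h Y Y'] by (auto simp: graph_iso_def)

text \<open>Arcs of a product are pairs of arcs, so pairs of automorphisms suffice for arc-transitivity. The
  adjacency operator is the composition of the two operators that act on one coordinate each, and each
  of them is injective.\<close>

lemma tensor_factor_tensor:
  assumes "tensor_factor X R d" "tensor_factor Y Q e"
  shows "tensor_factor (X \<times> Y) (tensor R Q) (d * e)"
proof -
  interpret X: tensor_factor X R d by fact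
  interpret Y: tensor_factor Y Q e by fact
  show ?thesis
  proof
    show "finite (X \<times> Y)" using X.fin Y.fin by simp
    show "tensor R Q v u" if "u \<in> X \<times> Y" "v \<in> X \<times> Y" "tensor R Q u v" for u v
      using that X.sym Y.sym by auto
    show "d * e > 0" using X.pos Y.pos by simp
    show "card (nbrs (X \<times> Y) (tensor R Q) u) = d * e" if "u \<in> X \<times> Y" for u
      using that X.reg Y.reg by (auto simp: nbrs_tensor card_cartesian_product)
    show "\<exists>g. graph_iso g (X \<times> Y) (tensor R Q) (X \<times> Y) (tensor R Q) \<and> g u = u' \<and> g v = v'"
      if uv: "u \<in> X \<times> Y" "v \<in> X \<times> Y" "u' \<in> X \<times> Y" "v' \<in> X \<times> Y"
        "tensor R Q u v" "tensor R Q u' v'" for u v u' v'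
    proof -
      obtain x a y b x' a' y' b' where eq: "u = (x, a)" "v = (y, b)" "u' = (x', a')" "v' = (y', b')"
        by (metis surj_pair)
      obtain g where g: "graph_iso g X R X R" "g x = x'" "g y = y'"
        using X.arc[of x y x' y'] uv eq by auto
      obtain h where h: "graph_iso h Y Q Y Q" "h a = a'" "h b = b'"
        using Y.arc[of a b a' b'] uv eq by auto
      show ?thesis
        using graph_iso_tensor[OF g(1) h(1)] g h by (intro exI[of _ "map_prod g h"]) (simp add: eq)
    qed
    show "f u = 0" if z: "\<And>u. u \<in> X \<times> Y \<Longrightarrow> (\<Sum>v\<in>nbrs (X \<times> Y) (tensor R Q) u. f v) = (0::real)"
      and "u \<in> X \<times> Y" for f u
    proof -
      have z': "(\<Sum>b\<in>nbrs Y Q a. \<Sum>y\<in>nbrs X R x. f (y, b)) = 0" if "x \<in> X" "a \<in> Y" for x a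
        using z[of "(x, a)"] that
        by (subst sum.swap) (simp add: nbrs_tensor sum.cartesian_product)
      have "(\<Sum>y\<in>nbrs X R x. f (y, b)) = 0" if "x \<in> X" "b \<in> Y" for x b
        using Y.nonsingular[of "\<lambda>b. \<Sum>y\<in>nbrs X R x. f (y, b)"] z' that by blast
      then have "f (x, b) = 0" if "x \<in> X" "b \<in> Y" for x b
        using X.nonsingular[of "\<lambda>y. f (y, b)"] that by blast
      then show ?thesis using that by auto
    qed
  qed
qed

section \<open>Identity and complete graphs\<close>

text \<open>The symmetric group is transitive on pairs of the same equality type: the first transposition moves
  \<open>x\<close> to \<open>x'\<close>, the second one corrects the image of \<open>y\<close>.\<close>

lemma transposition_pair:
  fixes x y x' y' :: 'a
  assumes "x = y \<longleftrightarrow> x' = y'" and "{x, y, x', y'} \<subseteq> X"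
  obtains g where "bij_betw g X X" "g x = x'" "g y = y'"
proof -
  define z where "z = transpose x x' y"
  define g where "g = transpose z y' \<circ> transpose x x'"
  have bij: "bij_betw (transpose a b) X X" if "a \<in> X" "b \<in> X" for a b
    using that by (intro bij_betwI[where g = "transpose a b"]) (auto simp: transpose_def)
  have "z \<in> X" using assms(2) by (auto simp: z_def transpose_def)
  then have "bij_betw g X X"
    unfolding g_def using assms(2) by (intro bij_betw_trans[OF bij bij]) auto
  moreover have "z \<noteq> x' \<and> x' \<noteq> y' \<or> z = x' \<and> x' = y'"
    using assms(1) by (auto simp: z_def transpose_def)
  then have "g x = x'" by (auto simp: g_def transpose_def)
  moreover have "g y = y'" by (simp add: g_def z_def)
  ultimately show ?thesis using that by blast
qed

lemma tensor_factor_identity: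
  assumes "finite X"
  shows "tensor_factor X (=) 1"
proof
  have nb: "nbrs X (=) x = {x}" if "x \<in> X" for x using that by (auto simp: nbrs_def)
  show "card (nbrs X (=) x) = 1" if "x \<in> X" for x using nb[OF that] by simp
  show "f x = 0" if "\<And>x. x \<in> X \<Longrightarrow> (\<Sum>y\<in>nbrs X (=) x. f y) = (0::real)" "x \<in> X" for f x
    using that(1)[OF that(2)] nb[OF that(2)] by simp
  show "\<exists>g. graph_iso g X (=) X (=) \<and> g x = x' \<and> g y = y'"
    if "x \<in> X" "y \<in> X" "x' \<in> X" "y' \<in> X" "x = y" "x' = y'" for x y x' y'
  proof -
    obtain g where "bij_betw g X X" "g x = x'" "g y = y'"
      using transposition_pair[of x y x' y' X] \<open>x \<in> X\<close> \<open>y \<in> X\<close> \<open>x' \<in> X\<close> \<open>y' \<in> X\<close> \<open>x = y\<close> \<open>x' = y'\<close>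
      by auto
    then show ?thesis by (auto simp: graph_iso_def bij_betw_def inj_on_eq_iff)
  qed
qed (use assms in auto)

text \<open>A function in the null space takes the same value \<open>\<sigma>\<close>, its total sum, at each of the \<open>k \<ge> 2\<close>
  vertices; then \<open>\<sigma> = k \<sigma>\<close> forces \<open>\<sigma> = 0\<close>.\<close>

lemma tensor_factor_complete:
  assumes "finite X" "card X \<ge> 2"
  shows "tensor_factor X (\<noteq>) (card X - 1)"
proof
  have nb: "nbrs X (\<noteq>) x = X - {x}" for x by (auto simp: nbrs_def)
  show "card (nbrs X (\<noteq>) x) = card X - 1" if "x \<in> X" for x using assms that by (simp add: nb)
  show "f x = 0" if z: "\<And>x. x \<in> X \<Longrightarrow> (\<Sum>y\<in>nbrs X (\<noteq>) x. f y) = (0::real)" and "x \<in> X" for f x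
  proof -
    have f: "f x = sum f X" if "x \<in> X" for x
      using z[OF that] assms that by (simp add: nb sum_diff1)
    have "sum f X = (\<Sum>x\<in>X. sum f X)" by (rule sum.cong[OF refl f])
    then have "sum f X = real (card X) * sum f X" by (simp only: sum_constant)
    then have "sum f X = 0" using assms by simp
    then show ?thesis using f[OF \<open>x \<in> X\<close>] by metis
  qed
  show "\<exists>g. graph_iso g X (\<noteq>) X (\<noteq>) \<and> g x = x' \<and> g y = y'"
    if "x \<in> X" "y \<in> X" "x' \<in> X" "y' \<in> X" "x \<noteq> y" "x' \<noteq> y'" for x y x' y'
  proof -
    obtain g where "bij_betw g X X" "g x = x'" "g y = y'"
      using transposition_pair[of x y x' y' X] \<open>x \<in> X\<close> \<open>y \<in> X\<close> \<open>x' \<in> X\<close> \<open>y' \<in> X\<close> \<open>x \<noteq> y\<close> \<open>x' \<noteq> y'\<close>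
      by auto
    then show ?thesis by (auto simp: graph_iso_def bij_betw_def inj_on_eq_iff)
  qed
qed (use assms in auto)

section \<open>Circulant graphs\<close>

definition circulant :: "int \<Rightarrow> int set \<Rightarrow> int \<Rightarrow> int \<Rightarrow> bool" where
  "circulant N S x y \<longleftrightarrow> (y - x) mod N \<in> S"

lemma sum_nbrs_circulant:
  assumes "N > 0" "S \<subseteq> {0..<N}" "x \<in> {0..<N}"
  shows card_nbrs_circulant: "card (nbrs {0..<N} (circulant N S) x) = card S"
    and "sum f (nbrs {0..<N} (circulant N S) x) = (\<Sum>s\<in>S. f ((x + s) mod N))"
proof -
  have inj: "inj_on (\<lambda>s. (x + s) mod N) S"
  proof (rule inj_onI)
    fix s s' assume s: "s \<in> S" "s' \<in> S" "(x + s) mod N = (x + s') mod N"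
    then have "(x + s - x) mod N = (x + s' - x) mod N" by (rule_tac mod_diff_cong) auto
    then show "s = s'" using s assms(2) by (auto simp: subset_iff)
  qed
  have "nbrs {0..<N} (circulant N S) x = (\<lambda>s. (x + s) mod N) ` S"
  proof (intro equalityI subsetI)
    fix y assume y: "y \<in> nbrs {0..<N} (circulant N S) x"
    then have "(x + (y - x) mod N) mod N = y" by (simp add: nbrs_def mod_simps)
    then show "y \<in> (\<lambda>s. (x + s) mod N) ` S"
      using y by (auto simp: nbrs_def circulant_def intro!: rev_image_eqI)
  next
    fix y assume "y \<in> (\<lambda>s. (x + s) mod N) ` S"
    then obtain s where "s \<in> S" "y = (x + s) mod N" by auto
    moreover have "((x + s) mod N - x) mod N = s mod N" by (simp add: mod_simps)
    ultimately show "y \<in> nbrs {0..<N} (circulant N S) x"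
      using assms by (auto simp: nbrs_def circulant_def subset_iff)
  qed
  then show "card (nbrs {0..<N} (circulant N S) x) = card S"
    "sum f (nbrs {0..<N} (circulant N S) x) = (\<Sum>s\<in>S. f ((x + s) mod N))"
    using inj by (simp_all add: card_image sum.reindex)
qed

text \<open>A subgroup of the unit group modulo \<open>N\<close> that contains \<open>- 1\<close>. The exponent \<open>e\<close> replaces explicit
  inverses: the inverse of \<open>s\<close> is \<open>s ^ (e - 1)\<close>.\<close>

locale unit_subgroup =
  fixes N :: int and S :: "int set" and e :: nat
  assumes N: "N > 1" and range: "S \<subseteq> {0..<N}" and e: "e > 0"
    and mult: "\<lbrakk>s \<in> S; t \<in> S\<rbrakk> \<Longrightarrow> s * t mod N \<in> S"
    and exponent: "s \<in> S \<Longrightarrow> s ^ e mod N = 1"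
    and neg_one: "N - 1 \<in> S"
begin

lemma power_mem: "s \<in> S \<Longrightarrow> s ^ Suc k mod N \<in> S"
proof (induction k)
  case 0
  then show ?case using range by auto
next
  case (Suc k)
  then have "s * (s ^ Suc k mod N) mod N \<in> S" by (intro mult) auto
  then show ?case by (simp add: mod_simps)
qed

lemma one_mem: "1 \<in> S"
proof -
  obtain k where "e = Suc k" using e by (cases e) auto
  then show ?thesis using power_mem[OF neg_one, of k] exponent[OF neg_one] by simp
qed

lemma mult_mem_iff:
  assumes u: "u mod N \<in> S"
  shows "u * x mod N \<in> S \<longleftrightarrow> x mod N \<in> S"
proof
  show "u * x mod N \<in> S" if "x mod N \<in> S"
    using mult[OF u that] by (simp add: mod_simps)
next
  assume ux: "u * x mod N \<in> S"
  have e1: "u ^ e mod N = 1" using exponent[OF u] by (simp add: power_mod)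
  show "x mod N \<in> S"
  proof (cases "e = 1")
    case True
    then have "u * x mod N = x mod N" using e1 by (metis mod_mult_left_eq mult_1 power_one_right)
    then show ?thesis using ux by simp
  next
    case False
    then obtain k where k: "e = Suc (Suc k)" using e by (metis One_nat_def not0_implies_Suc not_gr0)
    have "((u mod N) ^ Suc k mod N) * (u * x mod N) mod N \<in> S"
      by (intro mult power_mem u ux)
    moreover have "((u mod N) ^ Suc k mod N) * (u * x mod N) mod N = u ^ Suc k * (u * x) mod N"
      by (metis mod_mult_eq power_mod)
    also have "u ^ Suc k * (u * x) = u ^ e * x" by (simp add: k)
    also have "u ^ e * x mod N = x mod N" using e1 by (metis mod_mult_left_eq mult_1)
    finally show ?thesis by simp
  qed
qed

lemma uminus_mem: "x mod N \<in> S \<Longrightarrow> (- x) mod N \<in> S"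
proof -
  assume "x mod N \<in> S"
  then have "(N - 1) * (x mod N) mod N \<in> S" by (rule mult[OF neg_one])
  moreover have "(N - 1) * (x mod N) mod N = ((N - 1) * x) mod N" by (simp add: mod_simps)
  moreover have "(N - 1) * x = - x + x * N" by (simp add: algebra_simps)
  ultimately show ?thesis by (metis mod_mult_self1)
qed

lemma quotient:
  assumes "s \<in> S" "t \<in> S"
  obtains u where "u mod N \<in> S" "u * s mod N = t"
proof -
  obtain k where k: "e = Suc k" using e by (cases e) auto
  have "t * (s ^ e) mod N = t" using exponent[OF assms(1)] range assms(2)
    by (metis atLeastLessThan_iff mod_mult_right_eq mod_pos_pos_trivial mult.right_neutral subset_iff)
  then have ts: "(t * s ^ k) * s mod N = t" by (simp add: k ac_simps)
  have "(t * s ^ k) mod N \<in> S"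
    using mult[OF assms(2) power_mem[OF assms(1)]] mult_mem_iff[of s "t * s ^ k"] ts assms range
    by (simp add: mult.commute subset_iff)
  with ts that show ?thesis by blast
qed

lemma affine_graph_iso:
  assumes u: "u mod N \<in> S"
  shows "graph_iso (\<lambda>z. (u * (z - x) + x') mod N) {0..<N} (circulant N S) {0..<N} (circulant N S)"
proof -
  have "u ^ e mod N = 1" using exponent[OF u] by (simp add: power_mod)
  then have "coprime (u ^ e) N" using N by (metis coprime_1_left coprime_mod_left_iff less_irrefl
        not_one_less_zero)
  then have cop: "coprime u N" using e by simp
  have inj: "inj_on (\<lambda>z. (u * (z - x) + x') mod N) {0..<N}"
  proof (rule inj_onI)
    fix y z assume yz: "y \<in> {0..<N}" "z \<in> {0..<N}"
      and eq: "(u * (y - x) + x') mod N = (u * (z - x) + x') mod N"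
    have "N dvd (u * (y - x) + x') - (u * (z - x) + x')" using eq by (simp add: mod_eq_dvd_iff)
    also have "\<dots> = u * (y - z)" by (simp add: algebra_simps)
    finally have "N dvd y - z" using cop by (simp add: coprime_commute coprime_dvd_mult_right_iff)
    then have "y mod N = z mod N" by (simp add: mod_eq_dvd_iff)
    then show "y = z" using yz by simp
  qed
  have "(\<lambda>z. (u * (z - x) + x') mod N) ` {0..<N} \<subseteq> {0..<N}" using N by auto
  then have "bij_betw (\<lambda>z. (u * (z - x) + x') mod N) {0..<N} {0..<N}"
    using inj by (simp add: bij_betw_def endo_inj_surj)
  moreover have "circulant N S ((u * (y - x) + x') mod N) ((u * (z - x) + x') mod N)
      \<longleftrightarrow> circulant N S y z" for y z
  proof -
    have "((u * (z - x) + x') mod N - (u * (y - x) + x') mod N) mod N = u * (z - y) mod N"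
      by (simp add: mod_simps) (simp add: algebra_simps)
    then show ?thesis using mult_mem_iff[OF u] by (simp add: circulant_def)
  qed
  ultimately show ?thesis by (simp add: graph_iso_def)
qed

text \<open>Multiplications by elements of the connection set and translations are automorphisms, and the affine
  maps built from them are transitive on arcs. Symmetry holds because \<open>- 1\<close> is in the subgroup.\<close>

lemma tensor_factor_circulant:
  assumes nonsingular: "\<And>f x. \<lbrakk>\<And>x. f (x mod N) = f x; \<And>x. (\<Sum>s\<in>S. f (x + s)) = (0::real)\<rbrakk>
    \<Longrightarrow> f x = 0"
  shows "tensor_factor {0..<N} (circulant N S) (card S)"
proof
  show "circulant N S y x" if "circulant N S x y" for x y
    using uminus_mem[of "y - x"] that by (simp add: circulant_def)
  show "card S > 0" using one_mem range finite_subset[OF range] by (auto simp: card_gt_0_iff)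
  show "card (nbrs {0..<N} (circulant N S) x) = card S" if "x \<in> {0..<N}" for x
    using that N range by (intro card_nbrs_circulant) auto
  show "\<exists>g. graph_iso g {0..<N} (circulant N S) {0..<N} (circulant N S) \<and> g x = x' \<and> g y = y'"
    if xy: "x \<in> {0..<N}" "y \<in> {0..<N}" "x' \<in> {0..<N}" "y' \<in> {0..<N}"
      "circulant N S x y" "circulant N S x' y'" for x y x' y'
  proof -
    obtain u where u: "u mod N \<in> S" "u * ((y - x) mod N) mod N = (y' - x') mod N"
      using quotient xy(5,6) by (metis circulant_def)
    have "(u * (y - x) + x') mod N = ((y' - x') + x') mod N"
      using u(2) by (intro mod_add_cong) (auto simp: mod_simps)
    then have "(u * (y - x) + x') mod N = y'" using xy by simp
    then show ?thesis
      using affine_graph_iso[OF u(1), of x x'] xy by (intro exI[of _ "\<lambda>z. (u * (z - x) + x') mod N"]) simp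
  qed
  show "f x = 0" if z: "\<And>x. x \<in> {0..<N} \<Longrightarrow> (\<Sum>y\<in>nbrs {0..<N} (circulant N S) x. f y) = (0::real)"
    and x: "x \<in> {0..<N}" for f x
  proof -
    have "f (x mod N) = 0"
    proof (rule nonsingular[of "\<lambda>y. f (y mod N)"])
      show "(\<Sum>s\<in>S. f ((y + s) mod N)) = 0" for y
        using z[of "y mod N"] sum_nbrs_circulant(2)[of N S "y mod N" f] N range by (simp add: mod_simps)
    qed simp
    then show ?thesis using x by simp
  qed
qed simp

end

section \<open>Circulants of prime order are nonsingular\<close>

definition fdiff :: "(int \<Rightarrow> int) \<Rightarrow> int \<Rightarrow> int" where
  "fdiff f x = f (x + 1) - f x"

lemma funpow_fdiff:
  "(fdiff ^^ k) f x = (\<Sum>j\<le>k. (-1) ^ (k + j) * of_nat (k choose j) * f (x + int j))"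
proof (induction k arbitrary: x)
  case 0
  then show ?case by simp
next
  case (Suc k)
  let ?c = "\<lambda>j. (-1) ^ (k + j) :: int"
  have "(fdiff ^^ Suc k) f x =
      (\<Sum>j\<le>k. ?c j * of_nat (k choose j) * f (x + 1 + int j)) -
      (\<Sum>j\<le>k. ?c j * of_nat (k choose j) * f (x + int j))"
    by (simp add: fdiff_def Suc.IH)
  also have "(\<Sum>j\<le>k. ?c j * of_nat (k choose j) * f (x + int j)) =
      (\<Sum>j\<le>Suc k. ?c j * of_nat (k choose j) * f (x + int j))"
    by simp
  also have "\<dots> = ?c 0 * f x +
      (\<Sum>j\<le>k. ?c (Suc j) * of_nat (k choose Suc j) * f (x + int (Suc j)))"
    by (subst sum.atMost_Suc_shift) simp
  also have "(\<Sum>j\<le>k. ?c j * of_nat (k choose j) * f (x + 1 + int j)) - \<dots> =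
      - ?c 0 * f x + ((\<Sum>j\<le>k. ?c j * of_nat (k choose j) * f (x + 1 + int j)) -
        (\<Sum>j\<le>k. ?c (Suc j) * of_nat (k choose Suc j) * f (x + int (Suc j))))"
    by simp
  also have "\<dots> = - ?c 0 * f x + (\<Sum>j\<le>k. ?c j * of_nat (Suc k choose Suc j) * f (x + int (Suc j)))"
    unfolding sum_subtractf[symmetric]
    by (intro arg_cong2[where f = "(+)"] sum.cong) (simp_all add: algebra_simps)
  also have "\<dots> = (\<Sum>j\<le>Suc k. (-1) ^ (Suc k + j) * of_nat (Suc k choose j) * f (x + int j))"
    by (subst sum.atMost_Suc_shift) simp
  finally show ?case .
qed

text \<open>Differences commute with the circulant operator, so they preserve its null space.\<close>

lemma funpow_fdiff_sum_zero:
  assumes "\<And>x. (\<Sum>s\<in>S. f (x + s)) = 0"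
  shows "(\<Sum>s\<in>S. (fdiff ^^ k) f (x + s)) = 0"
proof (induction k arbitrary: x)
  case (Suc k)
  have "(\<Sum>s\<in>S. (fdiff ^^ Suc k) f (x + s)) =
      (\<Sum>s\<in>S. (fdiff ^^ k) f ((x + 1) + s)) - (\<Sum>s\<in>S. (fdiff ^^ k) f (x + s))"
    by (simp add: fdiff_def sum_subtractf algebra_simps)
  then show ?case using Suc by simp
qed (simp add: assms)

text \<open>The inner binomial coefficients vanish modulo \<open>p\<close>, so the \<open>p\<close>-th difference is congruent to
  \<open>f (x + p) - f x\<close>: on functions of period \<open>p\<close> the difference operator is nilpotent modulo \<open>p\<close>.\<close>

lemma prime_dvd_funpow_fdiff:
  assumes p: "prime p" "odd p" and periodic: "\<And>x. f (x + int p) = f x"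
  shows "int p dvd (fdiff ^^ p) f x"
proof -
  let ?t = "\<lambda>j. (-1) ^ (p + j) * int (p choose j) * f (x + int j)"
  have p0: "p > 0" using p by (simp add: prime_gt_0_nat)
  have "{..p} = insert 0 (insert p {1..<p})" using p0 by auto
  then have "sum ?t {..p} = ?t 0 + (?t p + sum ?t {1..<p})" using p0 by simp
  also have "\<dots> = sum ?t {1..<p}" using p(2) periodic by simp
  finally have "(fdiff ^^ p) f x = sum ?t {1..<p}" by (simp add: funpow_fdiff)
  moreover have "int p dvd ?t j" if "j \<in> {1..<p}" for j
    using that p(1) by (intro dvd_mult2 dvd_mult) (auto intro!: dvd_choose_prime)
  then have "int p dvd sum ?t {1..<p}" by (rule dvd_sum)
  ultimately show ?thesis by simp
qed

text \<open>All differences of \<open>f\<close> satisfy the same circulant equation. Starting from the \<open>p\<close>-th one, which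
  vanishes modulo \<open>p\<close>, one descends: if the next difference vanishes modulo \<open>p\<close>, then the present one
  is constant modulo \<open>p\<close>, and the circulant equation says that \<open>card S\<close> times this constant is 0.\<close>

lemma prime_dvd_circulant_kernel:
  assumes p: "prime p" "odd p" and periodic: "\<And>x. f (x + int p) = f x"
    and zero: "\<And>x. (\<Sum>s\<in>S. f (x + s)) = 0" and S: "\<not> p dvd card S"
  shows "int p dvd f x"
proof -
  have "int p dvd (fdiff ^^ (p - k)) f x" if "k \<le> p" for k x
    using that
  proof (induction k arbitrary: x)
    case 0
    then show ?case using prime_dvd_funpow_fdiff[of p f x] p periodic by simp
  next
    case (Suc k)
    define g where "g = (fdiff ^^ (p - Suc k)) f"
    have "p - k = Suc (p - Suc k)" using Suc.prems by simp
    then have "int p dvd fdiff g y" for y using Suc.IH[of y] Suc.prems by (simp add: g_def)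
    then have step: "g (y + 1) mod int p = g y mod int p" for y
      by (simp add: fdiff_def mod_eq_dvd_iff)
    have const: "g (x + s) mod int p = g x mod int p" for s
    proof (induction s rule: int_induct[where k = 0])
      case (step1 i)
      then show ?case using step[of "x + i"] by (simp add: add.assoc)
    next
      case (step2 i)
      then show ?case using step[of "x + (i - 1)"] by simp
    qed simp
    have "(\<Sum>s\<in>S. g (x + s)) mod int p = (\<Sum>s\<in>S. g x) mod int p"
      by (subst (1 2) mod_sum_eq[symmetric]) (simp only: const)
    then have "int p dvd int (card S) * g x"
      using funpow_fdiff_sum_zero[OF zero, of "p - Suc k" x]
      by (simp add: g_def mod_eq_0_iff_dvd[symmetric])
    then show ?case using S p(1) unfolding g_def
      by (metis int_dvd_int_iff prime_dvd_mult_iff prime_nat_int_transfer)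
  qed
  from this[of p x] show ?thesis by simp
qed

text \<open>An integer solution is divisible by \<open>p\<close>, the quotient is again a solution, and so on.\<close>

lemma circulant_kernel_int:
  assumes p: "prime p" "odd p" and S: "\<not> p dvd card S"
    and periodic: "\<And>x. f (x + int p) = f x"
    and zero: "\<And>x. (\<Sum>s\<in>S. f (x + s)) = (0::int)"
  shows "f x = 0"
proof -
  have descent: "int p ^ k dvd f x" for k
    using periodic zero
  proof (induction k arbitrary: f)
    case (Suc k)
    have p0: "int p \<noteq> 0" using p by auto
    have dvd: "int p dvd f y" for y
      using prime_dvd_circulant_kernel[OF p _ _ S, of f y] Suc.prems by blast
    define h where "h y = f y div int p" for y
    have fh: "f y = int p * h y" for y using dvd by (simp add: h_def)
    have "int p ^ k dvd h x"
    proof (rule Suc.IH)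
      show "h (y + int p) = h y" for y using Suc.prems(1) by (simp add: h_def)
      show "(\<Sum>s\<in>S. h (y + s)) = 0" for y
        using Suc.prems(2)[of y] p0 by (simp add: fh sum_distrib_left[symmetric])
    qed
    then show ?case by (simp add: fh)
  qed simp
  show ?thesis
  proof (rule ccontr)
    assume nz: "f x \<noteq> 0"
    define k where "k = nat \<bar>f x\<bar>"
    have "int p ^ k \<le> \<bar>f x\<bar>" using descent[of k] nz by (intro zdvd_imp_le) auto
    moreover have "k < 2 ^ k" by simp
    moreover have "(2::nat) ^ k \<le> p ^ k" using prime_ge_2_nat[OF p(1)] by (rule power_mono) simp
    ultimately show False unfolding k_def by (metis abs_ge_zero int_nat_eq linorder_not_less
          nat_less_le of_nat_le_iff of_nat_power order_trans)
  qed
qed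

lemma common_denominator:
  assumes "finite A"
  shows "\<exists>D::int. D > 0 \<and> (\<forall>x\<in>A. \<exists>z. of_int D * (f x :: rat) = of_int z)"
  using assms
proof induction
  case (insert a A)
  then obtain D where D: "D > 0" "\<forall>x\<in>A. \<exists>z. of_int D * f x = of_int z" by auto
  obtain r s where rs: "quotient_of (f a) = (r, s)" by force
  have s: "s > 0" "f a = of_int r / of_int s"
    using rs quotient_of_denom_pos quotient_of_div by auto
  have "\<exists>z. of_int (s * D) * f x = of_int z" if x: "x \<in> insert a A" for x
  proof (cases "x = a")
    case True
    then have "of_int (s * D) * f x = of_int (D * r)" using s by simp
    then show ?thesis by blast
  next
    case False
    then obtain z where "of_int D * f x = of_int z" using D x by auto
    then have "of_int (s * D) * f x = of_int (s * z)" by (simp add: mult.assoc)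
    then show ?thesis by blast
  qed
  then show ?case using s D by (intro exI[of _ "s * D"]) auto
qed (auto intro: exI[of _ 1])

lemma circulant_kernel_rat:
  assumes p: "prime p" "odd p" and S: "\<not> p dvd card S"
    and periodic: "\<And>x. f (x mod int p) = f x"
    and zero: "\<And>x. (\<Sum>s\<in>S. f (x + s)) = (0::rat)"
  shows "f x = 0"
proof -
  obtain D :: int where D: "D > 0" "\<forall>y\<in>{0..<int p}. \<exists>z. of_int D * f y = of_int z"
    using common_denominator[of "{0..<int p}" f] by auto
  have "\<exists>z. of_int D * f y = of_int z" for y
    using D(2)[rule_format, of "y mod int p"] p periodic[of y] by (auto simp: prime_gt_0_nat)
  then obtain h :: "int \<Rightarrow> int" where h: "of_int D * f y = of_int (h y)" for y by metis
  have "h x = 0"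
  proof (rule circulant_kernel_int[OF p S, of h x])
    show "h (y + int p) = h y" for y
    proof -
      have "f (y + int p) = f y" using periodic[of "y + int p"] periodic[of y] by simp
      then show ?thesis using h[of y] h[of "y + int p"] by simp
    qed
    show "(\<Sum>s\<in>S. h (y + s)) = 0" for y
    proof -
      have "(of_int (\<Sum>s\<in>S. h (y + s)) :: rat) = of_int D * (\<Sum>s\<in>S. f (y + s))"
        by (simp add: h sum_distrib_left)
      then show ?thesis using zero[of y] by (metis mult_zero_right of_int_eq_0_iff)
    qed
  qed
  then show ?thesis using h[of x] D(1) by simp
qed

text \<open>Real solutions of equations with integer coefficients are reduced to rational ones by a
  \<open>\<rat>\<close>-linear functional, obtained by extending \<open>{a}\<close> to a basis of the reals over the rationals.\<close>

lemma ex_additive_real_to_rat: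
  assumes "a \<noteq> 0"
  shows "\<exists>\<phi> :: real \<Rightarrow> rat. (\<forall>x y. \<phi> (x + y) = \<phi> x + \<phi> y) \<and> \<phi> a = 1"
proof -
  interpret vector_space_pair "\<lambda>q x. of_rat q * (x::real)" "\<lambda>q x. q * (x::rat)"
    by unfold_locales (auto simp: algebra_simps of_rat_add of_rat_mult)
  have "vs1.independent {a}" using assms by simp
  from linear_independent_extend[OF this, of "\<lambda>_. 1"]
  obtain \<phi> where \<phi>: "Vector_Spaces.linear (\<lambda>q x. of_rat q * x) (\<lambda>q x. q * x) \<phi>" "\<phi> a = 1" by auto
  interpret \<phi>: Vector_Spaces.linear "\<lambda>q x. of_rat q * (x::real)" "\<lambda>q x. q * (x::rat)" \<phi> by fact
  show ?thesis using \<phi>(2) \<phi>.add by blast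
qed

lemma circulant_kernel_real:
  assumes p: "prime p" "odd p" and S: "\<not> p dvd card S"
    and periodic: "\<And>x. f (x mod int p) = f x"
    and zero: "\<And>x. (\<Sum>s\<in>S. f (x + s)) = (0::real)"
  shows "f x = 0"
proof (rule ccontr)
  assume "f x \<noteq> 0"
  then obtain \<phi> :: "real \<Rightarrow> rat" where add: "\<And>x y. \<phi> (x + y) = \<phi> x + \<phi> y" and one: "\<phi> (f x) = 1"
    using ex_additive_real_to_rat by metis
  have \<phi>0: "\<phi> 0 = 0" using add[of 0 0] by simp
  have sum: "\<phi> (sum g A) = (\<Sum>a\<in>A. \<phi> (g a))" for g and A :: "int set"
    by (induction A rule: infinite_finite_induct) (auto simp: \<phi>0 add)
  then have "\<phi> (f x) = 0"
    using periodic zero \<phi>0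
    by (intro circulant_kernel_rat[OF p S, of "\<lambda>y. \<phi> (f y)"]) (simp_all flip: sum)
  with one show False by simp
qed

section \<open>Prime circulants over subgroups of units, and odd cycles\<close>

lemma unit_subgroup_roots_of_unity:
  assumes p: "prime p" "odd p" and d: "even d" "d > 0"
  shows "unit_subgroup (int p) {x \<in> {0..<int p}. x ^ d mod int p = 1} d"
proof
  have p3: "p \<ge> 3" using prime_ge_2_nat[OF p(1)] p(2) by (cases "p = 2") auto
  then show "int p > 1" by simp
  show "s * t mod int p \<in> {x \<in> {0..<int p}. x ^ d mod int p = 1}"
    if "s \<in> {x \<in> {0..<int p}. x ^ d mod int p = 1}" "t \<in> {x \<in> {0..<int p}. x ^ d mod int p = 1}"
    for s t
  proof -
    have "(s * t) ^ d mod int p = (s ^ d mod int p) * (t ^ d mod int p) mod int p"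
      by (simp add: power_mult_distrib mod_simps)
    then show ?thesis using that p3 by (simp add: power_mod)
  qed
  have "(int p - 1) ^ d mod int p = (- 1) ^ d mod int p"
    by (metis diff_0 minus_mod_self1 mod_diff_left_eq mod_self power_mod)
  then show "int p - 1 \<in> {x \<in> {0..<int p}. x ^ d mod int p = 1}" using d p3 by simp
qed (use d in auto)

text \<open>The \<open>i\<close>-th power of a primitive root is a \<open>d\<close>-th root of unity if and only if \<open>(p - 1) / d\<close>
  divides \<open>i\<close>, and there are \<open>d\<close> such exponents below \<open>p - 1\<close>.\<close>

lemma card_roots_of_unity:
  assumes p: "prime p" and d: "d > 0" "d dvd p - 1"
  shows "card {x \<in> {0..<int p}. x ^ d mod int p = 1} = d"
proof -
  have p2: "p \<ge> 2" using p by (rule prime_ge_2_nat)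
  obtain c where c: "p - 1 = c * d" using d(2) by (metis dvdE mult.commute)
  have c0: "c > 0" using c p2 by (cases c) auto
  obtain g where g: "residue_primroot p g" using prime_primitive_root_exists[of p] p p2 by auto
  have tot: "totient p = p - 1" using p by (rule totient_prime)
  have bij: "bij_betw (\<lambda>i. g ^ i mod p) {..<p - 1} (totatives p)"
    using residue_primroot_is_generator[OF _ g] p2 tot by simp
  have ord: "ord p g = p - 1" using g tot by (simp add: residue_primroot_def)
  have root: "(g ^ i mod p) ^ d mod p = 1 \<longleftrightarrow> c dvd i" for i
  proof -
    have "(g ^ i mod p) ^ d mod p = 1 \<longleftrightarrow> [g ^ (i * d) = 1] (mod p)"
      using p2 by (simp add: cong_def power_mod power_mult)
    also have "\<dots> \<longleftrightarrow> c * d dvd i * d" using ord_divides[of g "i * d" p] unfolding ord c .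
    finally show ?thesis using d(1) by simp
  qed
  have tota: "totatives p = {1..<p}" unfolding totatives_prime[OF p] by auto
  have img: "(\<lambda>i. g ^ i mod p) ` {i \<in> {..<p - 1}. c dvd i} = {x \<in> {1..<p}. x ^ d mod p = 1}"
  proof -
    have "(\<lambda>i. g ^ i mod p) ` {..<p - 1} = {1..<p}" using bij by (simp add: bij_betw_def tota)
    then have "{x \<in> {1..<p}. x ^ d mod p = 1} = {x \<in> (\<lambda>i. g ^ i mod p) ` {..<p - 1}. x ^ d mod p = 1}"
      by simp
    also have "\<dots> = (\<lambda>i. g ^ i mod p) ` {i \<in> {..<p - 1}. (g ^ i mod p) ^ d mod p = 1}" by blast
    finally show ?thesis by (simp only: root)
  qed
  have "{i \<in> {..<p - 1}. c dvd i} = (\<lambda>j. c * j) ` {..<d}"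
    using c c0 by (auto simp: image_iff elim!: dvdE)
  moreover have "inj_on (\<lambda>j. c * j) {..<d}" using c0 by (simp add: inj_on_def)
  ultimately have "card {i \<in> {..<p - 1}. c dvd i} = d" by (simp add: card_image)
  moreover have "inj_on (\<lambda>i. g ^ i mod p) {i \<in> {..<p - 1}. c dvd i}"
    using bij by (auto simp: bij_betw_def intro: inj_on_subset)
  ultimately have cardS: "card {x \<in> {1..<p}. x ^ d mod p = 1} = d"
    unfolding img[symmetric] by (simp add: card_image)
  have "{x \<in> {0..<int p}. x ^ d mod int p = 1} = int ` {x \<in> {1..<p}. x ^ d mod p = 1}"
  proof (intro equalityI subsetI)
    fix x assume x: "x \<in> {x \<in> {0..<int p}. x ^ d mod int p = 1}"
    then have "x = int (nat x)" by simp
    moreover from x have "int (nat x ^ d mod p) = 1" by (simp add: zmod_int)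
    then have "nat x ^ d mod p = 1" by simp
    moreover from this have "nat x \<noteq> 0" using d(1) by (metis One_nat_def mod_0 zero_neq_one zero_power)
    ultimately show "x \<in> int ` {x \<in> {1..<p}. x ^ d mod p = 1}" using x by (intro image_eqI[of _ _ "nat x"]) auto
  next
    fix x assume "x \<in> int ` {x \<in> {1..<p}. x ^ d mod p = 1}"
    then obtain y where y: "x = int y" "y < p" "y ^ d mod p = 1" by auto
    have "x ^ d mod int p = 1" unfolding y(1) using y(3) by (metis of_nat_1 of_nat_power zmod_int)
    then show "x \<in> {x \<in> {0..<int p}. x ^ d mod int p = 1}" using y by simp
  qed
  then show ?thesis using cardS by (simp add: card_image)
qed

lemma tensor_factor_roots_of_unity:
  assumes p: "prime p" "odd p" and d: "even d" "d dvd p - 1"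
  shows "tensor_factor {0..<int p} (circulant (int p) {x \<in> {0..<int p}. x ^ d mod int p = 1}) d"
proof -
  let ?S = "{x \<in> {0..<int p}. x ^ d mod int p = 1}"
  have p2: "p \<ge> 2" using p(1) by (rule prime_ge_2_nat)
  then have d0: "d > 0" using d(2) by (cases d) auto
  then interpret unit_subgroup "int p" ?S d by (intro unit_subgroup_roots_of_unity p d)
  have card: "card ?S = d" using p d d0 by (intro card_roots_of_unity)
  have "\<not> p dvd card ?S" unfolding card using d0 dvd_imp_le[OF d(2)] p2 by (auto dest!: dvd_imp_le)
  then have "f x = 0" if "\<And>x. f (x mod int p) = f x" "\<And>x. (\<Sum>s\<in>?S. f (x + s)) = (0::real)" for f x
    using circulant_kernel_real[of p ?S f x] p that by blast
  then have "tensor_factor {0..<int p} (circulant (int p) ?S) (card ?S)"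
    by (rule tensor_factor_circulant)
  then show ?thesis unfolding card .
qed

text \<open>A function \<open>f\<close> in the null space of a cycle satisfies \<open>f (x + 2) = - f x\<close>; going around twice takes
  \<open>a\<close> such steps, and for odd \<open>a\<close> this gives \<open>f x = - f x\<close>.\<close>

lemma tensor_factor_odd_cycle:
  assumes "odd a" "a \<ge> 3"
  shows "tensor_factor {0..<int a} (circulant (int a) {1, int a - 1}) 2"
    and "unit_subgroup (int a) {1, int a - 1} 2"
proof -
  let ?S = "{1, int a - 1}"
  have sq: "(int a - 1) * (int a - 1) mod int a = 1"
  proof -
    have "(int a - 1) * (int a - 1) = 1 + (int a - 2) * int a" by (simp add: algebra_simps)
    then have "(int a - 1) * (int a - 1) mod int a = 1 mod int a" by (metis mod_mult_self1)
    then show ?thesis using assms by simp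
  qed
  show unit: "unit_subgroup (int a) ?S 2"
    using assms sq by unfold_locales (auto simp: power2_eq_square zmod_minus1)
  interpret unit_subgroup "int a" ?S 2 by (rule unit)
  have "f x = 0" if periodic: "\<And>x. f (x mod int a) = f x"
    and zero: "\<And>x. (\<Sum>s\<in>?S. f (x + s)) = (0::real)" for f x
  proof -
    have alt: "f (y + 2) = - f y" for y
    proof -
      have "f (y + 1 + (int a - 1)) = f y" using periodic[of "y + int a"] periodic[of y] by simp
      then show ?thesis using zero[of "y + 1"] assms by (simp add: add.assoc)
    qed
    have "f (x + 2 * int k) = (- 1) ^ k * f x" for k
    proof (induction k)
      case (Suc k)
      have "x + 2 * int (Suc k) = (x + 2 * int k) + 2" by simp
      then show ?case using alt[of "x + 2 * int k"] Suc by (simp only:) simp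
    qed simp
    from this[of a] have "f (x + 2 * int a) = - f x" using assms(1) by simp
    moreover have "f (x + 2 * int a) = f x"
      using periodic[of "x + 2 * int a"] periodic[of x] by simp
    ultimately show ?thesis by simp
  qed
  then have "tensor_factor {0..<int a} (circulant (int a) ?S) (card ?S)"
    by (rule tensor_factor_circulant)
  moreover have "card ?S = 2" using assms by auto
  ultimately show "tensor_factor {0..<int a} (circulant (int a) ?S) 2" by simp
qed

section \<open>Connection by walks of even length\<close>

text \<open>Steps of length two instead of single edges: connectedness by such steps excludes at once
  disconnected and bipartite graphs, hence makes both the eigenvalue \<open>d\<close> simple and \<open>- d\<close> impossible.\<close>

definition two_step :: "'a set \<Rightarrow> ('a \<Rightarrow> 'a \<Rightarrow> bool) \<Rightarrow> 'a \<Rightarrow> 'a \<Rightarrow> bool" where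
  "two_step X R u v \<longleftrightarrow> u \<in> X \<and> v \<in> X \<and> (\<exists>w\<in>X. R u w \<and> R w v)"

definition two_step_connected :: "'a set \<Rightarrow> ('a \<Rightarrow> 'a \<Rightarrow> bool) \<Rightarrow> bool" where
  "two_step_connected X R \<longleftrightarrow> (\<forall>x\<in>X. \<forall>y\<in>X. (two_step X R)\<^sup>*\<^sup>* x y)"

lemma rtranclp_map:
  assumes "r\<^sup>*\<^sup>* x y" and "\<And>u v. r u v \<Longrightarrow> s (h u) (h v)"
  shows "s\<^sup>*\<^sup>* (h x) (h y)"
  using assms(1) by induction (auto intro: rtranclp.rtrancl_into_rtrancl assms(2))

lemma two_step_connected_graph_iso:
  assumes "two_step_connected X R" and iso: "graph_iso h X R Y Q"
  shows "two_step_connected Y Q"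
  unfolding two_step_connected_def
proof (intro ballI)
  fix u v assume "u \<in> Y" "v \<in> Y"
  then obtain x y where xy: "x \<in> X" "y \<in> X" "u = h x" "v = h y"
    using graph_iso_bij[OF iso] by (auto simp: bij_betw_def)
  have "two_step Y Q (h a) (h b)" if "two_step X R a b" for a b
    using that graph_iso_mem[OF iso] graph_iso_rel[OF iso] unfolding two_step_def by blast
  then show "(two_step Y Q)\<^sup>*\<^sup>* u v"
    using assms(1) xy rtranclp_map[of "two_step X R" x y "two_step Y Q" h]
    by (auto simp: two_step_connected_def)
qed

text \<open>Going back and forth along an edge is a two-step walk from a vertex to itself, so the two
  coordinates can be moved one after the other.\<close>

lemma two_step_connected_tensor:
  assumes "tensor_factor X R d" "tensor_factor Y Q e"
    and "two_step_connected X R" "two_step_connected Y Q"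
  shows "two_step_connected (X \<times> Y) (tensor R Q)"
  unfolding two_step_connected_def
proof clarify
  interpret X: tensor_factor X R d by fact
  interpret Y: tensor_factor Y Q e by fact
  fix x a y b assume xy: "x \<in> X" "a \<in> Y" "y \<in> X" "b \<in> Y"
  let ?P = "two_step (X \<times> Y) (tensor R Q)"
  have "\<exists>w\<in>Y. Q a w \<and> Q w a" using Y.ex_nbr xy(2) Y.sym by metis
  then have "?P (u, a) (v, a)" if "two_step X R u v" for u v
    using that xy(2) by (fastforce simp: two_step_def)
  then have "?P\<^sup>*\<^sup>* (x, a) (y, a)"
    using assms(3) xy by (intro rtranclp_map[where h = "\<lambda>u. (u, a)" and r = "two_step X R"]) (auto simp: two_step_connected_def)
  also have "\<exists>w\<in>X. R y w \<and> R w y" using X.ex_nbr xy(3) X.sym by metis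
  then have "?P (y, u) (y, v)" if "two_step Y Q u v" for u v
    using that xy(3) by (fastforce simp: two_step_def)
  then have "?P\<^sup>*\<^sup>* (y, a) (y, b)"
    using assms(4) xy by (intro rtranclp_map[where h = "\<lambda>u. (y, u)" and r = "two_step Y Q"]) (auto simp: two_step_connected_def)
  finally show "?P\<^sup>*\<^sup>* (x, a) (y, b)" .
qed

text \<open>Two steps along the connection 1 increase a vertex by 2, and 2 generates the integers modulo an odd
  number.\<close>

lemma (in unit_subgroup) two_step_connected_circulant:
  assumes "odd N"
  shows "two_step_connected {0..<N} (circulant N S)"
  unfolding two_step_connected_def
proof (intro ballI)
  fix x y assume xy: "x \<in> {0..<N}" "y \<in> {0..<N}"
  let ?P = "two_step {0..<N} (circulant N S)"
  have succ: "circulant N S (z mod N) ((z + 1) mod N)" for z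
    using one_mem N by (simp add: circulant_def mod_simps)
  have two: "?P (z mod N) ((z + 2) mod N)" for z
    using succ[of z] succ[of "z + 1"] N by (auto simp: two_step_def add.assoc intro!: bexI[of _ "(z + 1) mod N"])
  have step: "?P ((x + 2 * int k) mod N) ((x + 2 * int (Suc k)) mod N)" for k
  proof -
    have "x + 2 * int (Suc k) = (x + 2 * int k) + 2" by simp
    then show ?thesis using two[of "x + 2 * int k"] by (simp only:)
  qed
  have reach: "?P\<^sup>*\<^sup>* x ((x + 2 * int k) mod N)" for k
  proof (induction k)
    case 0
    then show ?case using xy by simp
  next
    case (Suc k)
    then show ?case using step[of k] by (rule rtranclp.rtrancl_into_rtrancl)
  qed
  \<comment> \<open>Half of \<open>y - x\<close> modulo \<open>N\<close> is the required number of steps, and \<open>h + 1\<close> is the inverse of 2.\<close>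
  obtain h where h: "N = 2 * h + 1" using assms by (elim oddE)
  define k where "k = nat ((y - x) * (h + 1) mod N)"
  have "int k = (y - x) * (h + 1) mod N" using N by (simp add: k_def)
  then have "(x + 2 * int k) mod N = (x + 2 * ((y - x) * (h + 1))) mod N"
    by (metis mod_add_right_eq mod_mult_right_eq)
  also have "x + 2 * ((y - x) * (h + 1)) = y + (y - x) * N" by (simp add: h algebra_simps)
  finally have "(x + 2 * int k) mod N = y" using xy by simp
  then show "?P\<^sup>*\<^sup>* x y" using reach[of k] by simp
qed

text \<open>Maximum principle: at a point where \<open>f\<close> is maximal, its value is the average over the ends of the
  two-step walks, so \<open>f\<close> is maximal at all these ends.\<close>

lemma (in tensor_factor) two_step_eigenfunction_constant:
  fixes f :: "'a \<Rightarrow> real"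
  assumes conn: "two_step_connected X R"
    and eig: "\<And>x. x \<in> X \<Longrightarrow> (\<Sum>w\<in>nbrs X R x. \<Sum>v\<in>nbrs X R w. f v) = real d * real d * f x"
    and xy: "x \<in> X" "y \<in> X"
  shows "f x = f y"
proof -
  have "Max (f ` X) \<in> f ` X" using xy fin by (intro Max_in) auto
  then obtain z where z: "z \<in> X" "f z = Max (f ` X)" by force
  have le: "f v \<le> f z" if "v \<in> X" for v using that fin by (simp add: z)
  have step: "f v = f z" if uv: "two_step X R u v" "f u = f z" for u v
  proof -
    obtain w where w: "u \<in> X" "v \<in> X" "w \<in> nbrs X R u" "v \<in> nbrs X R w"
      using uv(1) unfolding two_step_def nbrs_def by blast
    have nb: "t \<in> X" if "t \<in> nbrs X R s" for s t using that by (simp add: nbrs_def)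
    have "(\<Sum>w\<in>nbrs X R u. \<Sum>v\<in>nbrs X R w. f z - f v) =
        (\<Sum>w\<in>nbrs X R u. real d * f z - (\<Sum>v\<in>nbrs X R w. f v))"
      by (rule sum.cong) (simp_all add: sum_subtractf reg nb)
    also have "\<dots> = real d * (real d * f z) - real d * real d * f u"
      by (simp add: sum_subtractf reg[OF w(1)] eig[OF w(1)])
    finally have zero: "(\<Sum>w\<in>nbrs X R u. \<Sum>v\<in>nbrs X R w. f z - f v) = 0" using uv(2) by simp
    have nonneg: "(\<Sum>v\<in>nbrs X R w. f z - f v) \<ge> 0" for w
      by (intro sum_nonneg) (auto simp: le nb)
    have "(\<Sum>v\<in>nbrs X R w. f z - f v) = 0"
      using zero nonneg finite_nbrs w(3) by (subst (asm) sum_nonneg_eq_0_iff) auto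
    then have "f z - f v = 0"
      using finite_nbrs w(4) le nb by (subst (asm) sum_nonneg_eq_0_iff) auto
    then show ?thesis by simp
  qed
  have "f v = f z" if "v \<in> X" for v
  proof -
    have "(two_step X R)\<^sup>*\<^sup>* z v" using conn z that by (simp add: two_step_connected_def)
    then show ?thesis by induction (auto dest: step)
  qed
  then show ?thesis using xy by simp
qed

section \<open>Orders of factors\<close>

text \<open>There is a tensor factor of degree \<open>d\<close> on \<open>k\<close> points, free of loops if the flag \<open>l\<close> is set. Fixing
  the type of natural numbers allows products with a varying number of factors.\<close>

definition factor_order :: "bool \<Rightarrow> nat \<Rightarrow> nat \<Rightarrow> bool" where
  "factor_order l k d \<longleftrightarrow>
    (\<exists>R :: nat \<Rightarrow> nat \<Rightarrow> bool. tensor_factor {..<k} R d \<and> (l \<longrightarrow> (\<forall>x<k. \<not> R x x)))"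

lemma ex_nat_copy:
  assumes "finite X"
  obtains h :: "'a \<Rightarrow> nat" and Q where "graph_iso h X R {..<card X} Q"
  using ex_bij_betw_finite_nat[OF assms] graph_iso_copy[of _ X] by (metis atLeast0LessThan)

lemma graph_iso_loopless:
  assumes "graph_iso h X R Y Q" "\<And>x. x \<in> X \<Longrightarrow> \<not> R x x" "y \<in> Y"
  shows "\<not> Q y y"
  using assms by (auto simp: graph_iso_def bij_betw_def)

lemma factor_orderI:
  assumes "tensor_factor X R d" "l \<Longrightarrow> \<forall>x\<in>X. \<not> R x x" "card X = k"
  shows "factor_order l k d"
proof -
  have "finite X" using assms(1) by (rule tensor_factor.fin)
  then obtain h :: "'a \<Rightarrow> nat" and Q where iso: "graph_iso h X R {..<card X} Q" by (rule ex_nat_copy)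
  show ?thesis
    using tensor_factor_graph_iso[OF assms(1) iso] graph_iso_loopless[OF iso] assms(2,3)
    unfolding factor_order_def by (intro exI[of _ Q]) auto
qed

lemma factor_order_mono:
  assumes "factor_order l k d" "l' \<Longrightarrow> l"
  shows "factor_order l' k d"
  using assms by (auto simp: factor_order_def)

lemma factor_order_mult:
  assumes "factor_order l k d" "factor_order l' k' d'"
  shows "factor_order (l \<or> l') (k * k') (d * d')"
proof -
  obtain R Q where RQ: "tensor_factor {..<k} R d" "l \<longrightarrow> (\<forall>x<k. \<not> R x x)"
    "tensor_factor {..<k'} Q d'" "l' \<longrightarrow> (\<forall>x<k'. \<not> Q x x)"
    using assms by (auto simp: factor_order_def)
  show ?thesis
    by (rule factor_orderI[OF tensor_factor_tensor[OF RQ(1,3)]]) (use RQ in \<open>auto simp: card_cartesian_product\<close>)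
qed

lemma factor_order_identity: "factor_order False k 1"
  by (rule factor_orderI[OF tensor_factor_identity[of "{..<k}"]]) auto

lemma factor_order_complete: "k \<ge> 2 \<Longrightarrow> factor_order True k (k - 1)"
  using tensor_factor_complete[of "{..<k}"] by (intro factor_orderI[of "{..<k}" "(\<noteq>)"]) auto

lemma factor_order_prime:
  assumes "prime p" "odd p" "even d" "d dvd p - 1"
  shows "factor_order True p d"
proof (rule factor_orderI[OF tensor_factor_roots_of_unity[OF assms]])
  have "d > 0" using assms prime_ge_2_nat[of p] by (cases d) auto
  then show "\<forall>x\<in>{0..<int p}. \<not> circulant (int p) {x \<in> {0..<int p}. x ^ d mod int p = 1} x x"
    by (auto simp: circulant_def power_0_left)
qed auto

lemma factor_order_prod:
  fixes r :: nat
  assumes "\<And>i. i \<in> {1..r} \<Longrightarrow> factor_order True (k i) (d i)"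
  shows "factor_order (r > 0) (\<Prod>i=1..r. k i) (\<Prod>i=1..r. d i)"
  using assms
proof (induction r)
  case 0
  then show ?case using factor_order_identity[of 1] by simp
next
  case (Suc r)
  have "factor_order (r > 0 \<or> True) ((\<Prod>i=1..r. k i) * k (Suc r)) ((\<Prod>i=1..r. d i) * d (Suc r))"
    using Suc by (intro factor_order_mult) auto
  then show ?case by simp
qed

text \<open>The last two conditions go beyond a tensor factor: even walks make the null space one-dimensional,
  and without loops in \<open>B\<close> its tensor products are loopless for every second factor.\<close>

definition base_factor :: "nat \<Rightarrow> (nat \<Rightarrow> nat \<Rightarrow> bool) \<Rightarrow> bool" where
  "base_factor n B \<longleftrightarrow> tensor_factor {..<n} B 4 \<and> two_step_connected {..<n} B \<and> (\<forall>x<n. \<not> B x x)"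

lemma ex_base_factorI:
  assumes "tensor_factor X R 4" "two_step_connected X R" "\<And>x. x \<in> X \<Longrightarrow> \<not> R x x" "card X = n"
  shows "\<exists>B. base_factor n B"
proof -
  have "finite X" using assms(1) by (rule tensor_factor.fin)
  then obtain h :: "'a \<Rightarrow> nat" and Q where iso: "graph_iso h X R {..<card X} Q" by (rule ex_nat_copy)
  show ?thesis
    using tensor_factor_graph_iso[OF assms(1) iso] two_step_connected_graph_iso[OF assms(2) iso]
      graph_iso_loopless[OF iso assms(3)] assms(4)
    unfolding base_factor_def by (intro exI[of _ Q]) auto
qed

lemma ex_base_factor:
  assumes "n \<ge> 5" "odd n" "n mod 4 = 1 \<or> \<not> prime n"
  shows "\<exists>B. base_factor n B"
proof (cases "prime n")
  case True
  let ?S = "{x \<in> {0..<int n}. x ^ 4 mod int n = 1}"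
  from True have "n mod 4 = 1" using assms by simp
  then have "4 dvd n - 1" by presburger
  then have "tensor_factor {0..<int n} (circulant (int n) ?S) 4"
    using True assms by (intro tensor_factor_roots_of_unity) auto
  moreover have "two_step_connected {0..<int n} (circulant (int n) ?S)"
    using unit_subgroup.two_step_connected_circulant[OF unit_subgroup_roots_of_unity[of n 4]] True assms
    by simp
  ultimately show ?thesis by (rule ex_base_factorI) (auto simp: circulant_def)
next
  case False
  then obtain a where a: "a dvd n" "a \<noteq> 1" "a \<noteq> n" using assms prime_nat_iff by auto
  then obtain b where b: "n = a * b" by auto
  have ab: "odd a" "odd b" "a \<ge> 3" "b \<ge> 3"
  proof -
    show odd: "odd a" "odd b" using b assms by auto
    have "b \<noteq> 1" using a b by auto
    with odd a(2) show "a \<ge> 3" "b \<ge> 3" by presburger+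
  qed
  note fa = tensor_factor_odd_cycle[OF ab(1,3)] and fb = tensor_factor_odd_cycle[OF ab(2,4)]
  show ?thesis
  proof (rule ex_base_factorI)
    show "tensor_factor ({0..<int a} \<times> {0..<int b})
        (tensor (circulant (int a) {1, int a - 1}) (circulant (int b) {1, int b - 1})) 4"
      using tensor_factor_tensor[OF fa(1) fb(1)] by simp
    show "two_step_connected ({0..<int a} \<times> {0..<int b})
        (tensor (circulant (int a) {1, int a - 1}) (circulant (int b) {1, int b - 1}))"
      using ab by (intro two_step_connected_tensor[OF fa(1) fb(1)]
          unit_subgroup.two_step_connected_circulant[OF fa(2)]
          unit_subgroup.two_step_connected_circulant[OF fb(2)]) auto
  qed (use ab b in \<open>auto simp: circulant_def card_cartesian_product\<close>)
qed

section \<open>From relations to nut graphs and orbit counts\<close>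

text \<open>Transfers the explicit description of the null space to its dimension in the sense of the matrix
  library.\<close>

lemma (in kernel) dim_eq_1:
  assumes x: "x \<in> carrier_vec nc" "x \<noteq> 0\<^sub>v nc" and ker: "mat_kernel A = {c \<cdot>\<^sub>v x | c. True}"
  shows "dim = 1"
proof -
  have xk: "x \<in> mat_kernel A" unfolding ker by (rule CollectI, rule exI[of _ 1]) simp
  have "mat_kernel A \<subseteq> span {x}"
  proof
    fix v assume v: "v \<in> mat_kernel A"
    then obtain c where c: "v = c \<cdot>\<^sub>v x" unfolding ker by auto
    have "lincomb (\<lambda>_. c) {x} \<in> mat_kernel A"
      using xk by (intro Ker.lincomb_closed) auto
    then have lc: "lincomb (\<lambda>_. c) {x} \<in> carrier_vec nc" using mat_kernel_carrier[OF A] by auto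
    have "v = lincomb (\<lambda>_. c) {x}"
      using x(1) lc xk c lincomb_index[of _ "{x}" "\<lambda>_. c"] by (intro eq_vecI) auto
    then show "v \<in> span {x}" unfolding Ker.span_def by (auto intro!: exI[of _ "{x}"] exI[of _ "\<lambda>_. c"])
  qed
  then have "Ker.gen_set {x}" using Ker.span_is_subset2[of "{x}"] xk by auto
  then show ?thesis using x(2) xk by (intro Ker.dim1I) auto
qed

definition edge_set :: "'a set \<Rightarrow> ('a \<Rightarrow> 'a \<Rightarrow> bool) \<Rightarrow> 'a set set" where
  "edge_set X R = {{u, v} | u v. u \<in> X \<and> v \<in> X \<and> R u v}"

text \<open>Vectors indexed by an enumeration of the vertices correspond to functions on the vertices, and the
  adjacency matrix to the sum over neighbours.\<close>

lemma nut_graph_edge_set: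
  assumes fin: "finite X" and sym: "\<And>x y. \<lbrakk>x \<in> X; y \<in> X; R x y\<rbrakk> \<Longrightarrow> R y x"
    and irrefl: "\<And>x. x \<in> X \<Longrightarrow> \<not> R x x" and "X \<noteq> {}"
    and full: "\<And>x. x \<in> X \<Longrightarrow> \<nu> x \<noteq> 0"
    and ker: "\<And>f. (\<forall>x\<in>X. (\<Sum>y\<in>nbrs X R x. f y) = (0::real)) \<longleftrightarrow> (\<exists>c. \<forall>x\<in>X. f x = c * \<nu> x)"
  shows "nut_graph X (edge_set X R)"
proof -
  have edge: "{u, v} \<in> edge_set X R \<longleftrightarrow> R u v" if "u \<in> X" "v \<in> X" for u v
    using that sym by (auto simp: edge_set_def doubleton_eq_iff)
  obtain vs where vs: "set vs = X" "distinct vs" using finite_distinct_list[OF fin] by auto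
  define N where "N = length vs"
  have N: "N = card X" "N > 0" using vs \<open>X \<noteq> {}\<close> by (auto simp: N_def distinct_card)
  have mem: "vs ! i \<in> X" if "i < N" for i using that vs by (auto simp: N_def)
  have bij: "bij_betw ((!) vs) {..<N} X" using vs by (simp add: N_def bij_betw_nth)
  let ?A = "adjacency_matrix vs (edge_set X R)"
  let ?vec = "\<lambda>f. vec N (\<lambda>i. f (vs ! i)) :: real vec"
  have A: "?A \<in> carrier_mat N N" by (simp add: adjacency_matrix_def N_def)
  have mult: "(?A *\<^sub>v ?vec f) $ i = (\<Sum>y\<in>nbrs X R (vs ! i). f y)" if i: "i < N" for f i
  proof -
    have "(?A *\<^sub>v ?vec f) $ i = (\<Sum>j\<in>{..<N}. (if R (vs ! i) (vs ! j) then f (vs ! j) else 0))"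
      using i mem edge by (auto simp: adjacency_matrix_def N_def[symmetric] scalar_prod_def
          atLeast0LessThan intro!: sum.cong)
    also have "\<dots> = (\<Sum>y\<in>X. if R (vs ! i) y then f y else 0)"
      by (rule sum.reindex_bij_betw[OF bij])
    finally show ?thesis by (simp add: nbrs_def sum.inter_filter fin)
  qed
  have kernel_iff: "?vec f \<in> mat_kernel ?A \<longleftrightarrow> (\<exists>c. \<forall>x\<in>X. f x = c * \<nu> x)" for f
  proof -
    have "?vec f \<in> mat_kernel ?A \<longleftrightarrow> (\<forall>i<N. (?A *\<^sub>v ?vec f) $ i = 0)"
      unfolding mat_kernel[OF A] using A by (auto simp: vec_eq_iff)
    also have "\<dots> \<longleftrightarrow> (\<forall>i<N. (\<Sum>y\<in>nbrs X R (vs ! i). f y) = 0)" using mult by simp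
    also have "\<dots> \<longleftrightarrow> (\<forall>x\<in>X. (\<Sum>y\<in>nbrs X R x. f y) = 0)"
      using bij by (auto simp: bij_betw_def)
    finally show ?thesis by (simp only: ker)
  qed
  have kernel: "mat_kernel ?A = {c \<cdot>\<^sub>v ?vec \<nu> | c. True}"
  proof (intro equalityI subsetI)
    fix v assume v: "v \<in> mat_kernel ?A"
    then have dim: "dim_vec v = N" using mat_kernel_carrier[OF A] by auto
    define f where "f y = v $ inv_into {..<N} ((!) vs) y" for y
    have "v = ?vec f" using dim bij by (intro eq_vecI) (auto simp: f_def bij_betw_inv_into_left)
    with v kernel_iff obtain c where c: "\<forall>x\<in>X. f x = c * \<nu> x" by auto
    then have "?vec f = c \<cdot>\<^sub>v ?vec \<nu>" using mem by (intro eq_vecI) auto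
    with \<open>v = ?vec f\<close> show "v \<in> {c \<cdot>\<^sub>v ?vec \<nu> | c. True}" by auto
  next
    fix v assume "v \<in> {c \<cdot>\<^sub>v ?vec \<nu> | c. True}"
    then obtain c where "v = c \<cdot>\<^sub>v ?vec \<nu>" by auto
    also have "\<dots> = ?vec (\<lambda>x. c * \<nu> x)" by (intro eq_vecI) auto
    finally show "v \<in> mat_kernel ?A" using kernel_iff[of "\<lambda>x. c * \<nu> x"] by auto
  qed
  have "?vec \<nu> \<noteq> 0\<^sub>v N" using full[OF mem] N(2) by (auto simp: vec_eq_iff)
  then have "kernel_dim ?A = 1"
    using kernel.dim_eq_1[of N N ?A "?vec \<nu>"] kernel A
    by (simp add: kernel_dim_def kernel_def)
  moreover have "simple_graph X (edge_set X R)"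
    unfolding simple_graph_def edge_set_def using fin irrefl by (auto simp: card_insert_if)
  ultimately show ?thesis
    unfolding nut_graph_def using vs kernel full[OF mem] N(1)
    by (intro conjI exI[of _ vs] bexI[of _ "?vec \<nu>"]) auto
qed

text \<open>What the glued graph has to satisfy, with \<open>X1\<close> and \<open>X2\<close> as the prospective vertex orbits. The three
  kinds of arcs in \<open>arcs\<close> correspond to the three edge orbits; \<open>\<nu>\<close> spans the null space.\<close>

locale two_orbit_nut =
  fixes X1 X2 :: "'a set" and R :: "'a \<Rightarrow> 'a \<Rightarrow> bool" and \<nu> :: "'a \<Rightarrow> real"
  assumes fin: "finite X1" "finite X2" and disj: "X1 \<inter> X2 = {}"
    and sym: "\<lbrakk>x \<in> X1 \<union> X2; y \<in> X1 \<union> X2; R x y\<rbrakk> \<Longrightarrow> R y x"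
    and irrefl: "x \<in> X1 \<union> X2 \<Longrightarrow> \<not> R x x"
    and degrees: "\<lbrakk>x \<in> X1; y \<in> X2\<rbrakk>
      \<Longrightarrow> card (nbrs (X1 \<union> X2) R x) \<noteq> card (nbrs (X1 \<union> X2) R y)"
    and cross: "x \<in> X1 \<Longrightarrow> \<exists>y\<in>X2. R x y" "y \<in> X2 \<Longrightarrow> \<exists>x\<in>X1. R x y"
    and inner: "\<exists>x\<in>X1. \<exists>y\<in>X1. R x y" "\<exists>x\<in>X2. \<exists>y\<in>X2. R x y"
    and arcs: "\<lbrakk>(P, Q) \<in> {(X1, X1), (X2, X2), (X1, X2)};
        x \<in> P; y \<in> Q; x' \<in> P; y' \<in> Q; R x y; R x' y'\<rbrakk>
      \<Longrightarrow> \<exists>g. graph_iso g (X1 \<union> X2) R (X1 \<union> X2) R \<and> g x = x' \<and> g y = y'"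
    and full: "x \<in> X1 \<union> X2 \<Longrightarrow> \<nu> x \<noteq> 0"
    and ker: "(\<forall>x\<in>X1 \<union> X2. (\<Sum>y\<in>nbrs (X1 \<union> X2) R x. f y) = (0::real))
      \<longleftrightarrow> (\<exists>c. \<forall>x\<in>X1 \<union> X2. f x = c * \<nu> x)"
begin

abbreviation "V \<equiv> X1 \<union> X2"
abbreviation "E \<equiv> edge_set V R"

lemma nut: "nut_graph V E"
proof (rule nut_graph_edge_set[OF _ sym irrefl _ full ker])
  show "V \<noteq> {}" using inner by auto
qed (use fin in auto)

lemma edge_iff: "\<lbrakk>u \<in> V; v \<in> V\<rbrakk> \<Longrightarrow> {u, v} \<in> E \<longleftrightarrow> R u v"
  using sym by (auto simp: edge_set_def doubleton_eq_iff)

lemma aut_iff: "g \<in> carrier (aut_group V E) \<longleftrightarrow> g \<in> extensional V \<and> graph_iso g V R V R"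
proof -
  have "(\<forall>u\<in>V. \<forall>v\<in>V. {g u, g v} \<in> E \<longleftrightarrow> {u, v} \<in> E) \<longleftrightarrow> (\<forall>u\<in>V. \<forall>v\<in>V. R (g u) (g v) \<longleftrightarrow> R u v)"
    if "bij_betw g V V"
    using edge_iff bij_betwE[OF that] by (intro ball_cong refl) blast
  then show ?thesis by (auto simp: aut_group_def BijGroup_def Bij_def graph_iso_def)
qed

lemma aut_restrict:
  assumes "graph_iso g V R V R"
  shows "restrict g V \<in> carrier (aut_group V E)"
proof -
  have "bij_betw (restrict g V) V V \<longleftrightarrow> bij_betw g V V" by (rule bij_betw_cong) simp
  then show ?thesis using assms unfolding aut_iff by (simp add: graph_iso_def)
qed

text \<open>Automorphisms preserve degrees, and the degrees separate \<open>X1\<close> from \<open>X2\<close>.\<close>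

lemma aut_mem:
  assumes "g \<in> carrier (aut_group V E)"
  shows "x \<in> X1 \<Longrightarrow> g x \<in> X1" "x \<in> X2 \<Longrightarrow> g x \<in> X2"
proof -
  have iso: "graph_iso g V R V R" using assms by (simp add: aut_iff)
  note g = graph_iso_mem[OF iso] card_nbrs_graph_iso[OF iso]
  show "g x \<in> X1" if "x \<in> X1" using g[of x] degrees[OF that, of "g x"] that by auto
  show "g x \<in> X2" if "x \<in> X2" using g[of x] degrees[OF _ that, of "g x"] that by auto
qed

definition "edges_between P Q = {{u, v} | u v. u \<in> P \<and> v \<in> Q \<and> R u v}"

text \<open>Every vertex lies on an edge between \<open>X1\<close> and \<open>X2\<close>, so transitivity on these edges implies
  transitivity on each half.\<close>

lemma vertex_orbit:
  shows "x \<in> X1 \<Longrightarrow> orbit (aut_group V E) (\<lambda>f v. f v) x = X1"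
    and "x \<in> X2 \<Longrightarrow> orbit (aut_group V E) (\<lambda>f v. f v) x = X2"
proof -
  have ex: "\<exists>g\<in>carrier (aut_group V E). g x = x' \<and> g y = y'"
    if xy: "x \<in> X1" "y \<in> X2" "x' \<in> X1" "y' \<in> X2" "R x y" "R x' y'" for x y x' y'
  proof -
    obtain g where g: "graph_iso g V R V R" "g x = x'" "g y = y'"
      using arcs[of X1 X2 x y x' y'] xy by auto
    then show ?thesis using xy by (intro bexI[OF _ aut_restrict[OF g(1)]]) auto
  qed
  show "orbit (aut_group V E) (\<lambda>f v. f v) x = X1" if "x \<in> X1"
    unfolding orbit_def using aut_mem(1) cross(1) ex that by (auto, metis)
  show "orbit (aut_group V E) (\<lambda>f v. f v) x = X2" if "x \<in> X2"
    unfolding orbit_def using aut_mem(2) cross(2) ex that by (auto, metis)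
qed

lemma num_vertex_orbits: "num_vertex_orbits V E = 2"
proof -
  have ne: "X1 \<noteq> {}" "X2 \<noteq> {}" using inner by auto
  have "orbits (aut_group V E) V (\<lambda>f v. f v) = (\<lambda>x. orbit (aut_group V E) (\<lambda>f v. f v) x) ` V"
    by (auto simp: orbits_def)
  also have "\<dots> = (\<lambda>x. X1) ` X1 \<union> (\<lambda>x. X2) ` X2" using vertex_orbit by (auto simp: image_Un)
  also have "\<dots> = {X1, X2}" using ne by auto
  finally show ?thesis using ne disj by (auto simp: num_vertex_orbits_def card_insert_if)
qed

lemma edge_orbit:
  assumes PQ: "(P, Q) \<in> {(X1, X1), (X2, X2), (X1, X2)}" and e: "e \<in> edges_between P Q"
  shows "orbit (aut_group V E) (\<lambda>f e. f ` e) e = edges_between P Q"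
proof -
  have PQV: "P \<subseteq> V" "Q \<subseteq> V" using PQ by auto
  obtain u v where uv: "e = {u, v}" "u \<in> P" "v \<in> Q" "R u v" using e by (auto simp: edges_between_def)
  show ?thesis
  proof (intro equalityI subsetI)
    fix e' assume "e' \<in> orbit (aut_group V E) (\<lambda>f e. f ` e) e"
    then obtain g where g: "g \<in> carrier (aut_group V E)" "e' = g ` e" by (auto simp: orbit_def)
    have "g u \<in> P" "g v \<in> Q" using aut_mem[OF g(1)] PQ uv by auto
    moreover have "R (g u) (g v)"
      using g(1) uv PQV by (auto simp: aut_iff graph_iso_def)
    ultimately show "e' \<in> edges_between P Q" using g(2) uv(1) by (auto simp: edges_between_def)
  next
    fix e' assume "e' \<in> edges_between P Q"
    then obtain u' v' where uv': "e' = {u', v'}" "u' \<in> P" "v' \<in> Q" "R u' v'"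
      by (auto simp: edges_between_def)
    obtain g where g: "graph_iso g V R V R" "g u = u'" "g v = v'"
      using arcs[OF PQ] uv uv' by blast
    have "e' = restrict g V ` e" using uv uv' g PQV by auto
    then show "e' \<in> orbit (aut_group V E) (\<lambda>f e. f ` e) e"
      using aut_restrict[OF g(1)] unfolding orbit_def by blast
  qed
qed

lemma num_edge_orbits: "num_edge_orbits V E = 3"
proof -
  let ?E11 = "edges_between X1 X1" and ?E22 = "edges_between X2 X2" and ?E12 = "edges_between X1 X2"
  let ?orb = "\<lambda>e. orbit (aut_group V E) (\<lambda>f e. f ` e) e"
  obtain a b where ab: "a \<in> X1" "b \<in> X1" "R a b" using inner by auto
  obtain c d where cd: "c \<in> X2" "d \<in> X2" "R c d" using inner by auto
  obtain w where w: "w \<in> X2" "R a w" using cross(1) ab(1) by auto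
  have m: "{a, b} \<in> ?E11" "{c, d} \<in> ?E22" "{a, w} \<in> ?E12"
    using ab cd w by (auto simp: edges_between_def)
  have E: "E = ?E11 \<union> ?E22 \<union> ?E12"
  proof (intro equalityI subsetI)
    fix e assume "e \<in> E"
    then obtain u v where uv: "e = {u, v}" "u \<in> V" "v \<in> V" "R u v" by (auto simp: edge_set_def)
    have "R v u" using sym uv by blast
    moreover have "e = {v, u}" using uv(1) by auto
    ultimately show "e \<in> ?E11 \<union> ?E22 \<union> ?E12" using uv unfolding edges_between_def by blast
  qed (auto simp: edges_between_def edge_set_def)
  have const: "?orb ` edges_between P Q = {edges_between P Q}"
    if "(P, Q) \<in> {(X1, X1), (X2, X2), (X1, X2)}" "e \<in> edges_between P Q" for P Q e
  proof -
    have "?orb ` edges_between P Q = (\<lambda>e. edges_between P Q) ` edges_between P Q"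
      using edge_orbit[OF that(1)] by (intro image_cong refl)
    then show ?thesis using that(2) by auto
  qed
  from E have "orbits (aut_group V E) E (\<lambda>f e. f ` e) = ?orb ` (?E11 \<union> ?E22 \<union> ?E12)"
    by (auto simp: orbits_def)
  also have "\<dots> = ?orb ` ?E11 \<union> ?orb ` ?E22 \<union> ?orb ` ?E12" by (simp only: image_Un)
  also have "?orb ` ?E11 = {?E11}" using m(1) by (intro const) auto
  also have "?orb ` ?E22 = {?E22}" using m(2) by (intro const) auto
  also have "?orb ` ?E12 = {?E12}" using m(3) by (intro const) auto
  finally have orb: "orbits (aut_group V E) E (\<lambda>f e. f ` e) = {?E11, ?E22, ?E12}" by auto
  have "{a, b} \<notin> ?E22" "{a, b} \<notin> ?E12" "{c, d} \<notin> ?E12"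
    using ab cd disj by (auto simp: edges_between_def doubleton_eq_iff)
  then have "?E11 \<noteq> ?E22" "?E11 \<noteq> ?E12" "?E22 \<noteq> ?E12" using m by auto
  then show ?thesis by (simp add: num_edge_orbits_def orb)
qed

end

text \<open>Allows the construction to use pairs as vertices although the vertices finally are natural numbers.\<close>

lemma two_orbit_nut_graph_iso:
  assumes "two_orbit_nut X1 X2 R \<nu>" and iso: "graph_iso h (X1 \<union> X2) R Y Q"
  shows "two_orbit_nut (h ` X1) (h ` X2) Q (\<lambda>y. \<nu> (inv_into (X1 \<union> X2) h y))"
proof -
  interpret two_orbit_nut X1 X2 R \<nu> by fact
  define k where "k = inv_into V h"
  note bij = graph_iso_bij[OF iso]
  have Y: "h ` X1 \<union> h ` X2 = Y" using bij by (auto simp: bij_betw_def)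
  have kh: "k (h x) = x" if "x \<in> V" for x
    using bij_betw_inv_into_left[OF bij that] by (simp add: k_def)
  note Q = graph_iso_rel[OF iso]
  have inv: "graph_iso k Y Q V R" unfolding k_def by (rule graph_iso_inv[OF iso])
  have all: "(\<forall>y\<in>Y. A y) \<longleftrightarrow> (\<forall>x\<in>V. A (h x))" for A using bij by (auto simp: bij_betw_def)
  show ?thesis
    unfolding two_orbit_nut_def Y k_def[symmetric]
  proof (intro conjI allI impI)
    show "h ` X1 \<inter> h ` X2 = {}" using disj bij by (auto simp: bij_betw_def inj_on_def)
    show "Q y x" if "x \<in> Y" "y \<in> Y" "Q x y" for x y
      using that sym Q unfolding Y[symmetric] by auto
    show "\<not> Q x x" if "x \<in> Y" for x using that irrefl Q unfolding Y[symmetric] by auto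
    show "card (nbrs Y Q x) \<noteq> card (nbrs Y Q y)" if "x \<in> h ` X1" "y \<in> h ` X2" for x y
      using that degrees card_nbrs_graph_iso[OF iso] by auto
    show "\<exists>y\<in>h ` X2. Q x y" if "x \<in> h ` X1" for x using that cross(1) Q by auto
    show "\<exists>x\<in>h ` X1. Q x y" if "y \<in> h ` X2" for y using that cross(2) Q by auto
    show "\<exists>x\<in>h ` X1. \<exists>y\<in>h ` X1. Q x y" using inner(1) Q by auto
    show "\<exists>x\<in>h ` X2. \<exists>y\<in>h ` X2. Q x y" using inner(2) Q by auto
    show "\<exists>g. graph_iso g Y Q Y Q \<and> g x = x' \<and> g y = y'"
      if H: "(P, S) \<in> {(h ` X1, h ` X1), (h ` X2, h ` X2), (h ` X1, h ` X2)}"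
        "x \<in> P" "y \<in> S" "x' \<in> P" "y' \<in> S" "Q x y" "Q x' y'" for P S x y x' y'
    proof -
      obtain P0 S0 where PS: "(P0, S0) \<in> {(X1, X1), (X2, X2), (X1, X2)}" "P = h ` P0" "S = h ` S0"
        using H(1) by auto
      have sub: "P0 \<subseteq> V" "S0 \<subseteq> V" using PS(1) by auto
      obtain a b a' b' where ab: "a \<in> P0" "b \<in> S0" "a' \<in> P0" "b' \<in> S0"
        "x = h a" "y = h b" "x' = h a'" "y' = h b'" using H PS by auto
      have "R a b" "R a' b'" using H(6,7) Q ab sub by auto
      then obtain g where g: "graph_iso g V R V R" "g a = a'" "g b = b'"
        using arcs[OF PS(1)] ab by blast
      have "graph_iso (h \<circ> (g \<circ> k)) Y Q Y Q"
        by (intro graph_iso_comp[OF _ iso] graph_iso_comp[OF inv g(1)])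
      moreover have "k x = a" "k y = b" using kh ab sub by auto
      ultimately show ?thesis using g ab by (intro exI[of _ "h \<circ> (g \<circ> k)"]) simp
    qed
    show "\<nu> (k x) \<noteq> 0" if "x \<in> Y" for x using graph_iso_mem[OF inv that] full by auto
    show "(\<forall>x\<in>Y. (\<Sum>y\<in>nbrs Y Q x. f y) = 0) \<longleftrightarrow> (\<exists>c. \<forall>x\<in>Y. f x = c * \<nu> (k x))" for f
    proof -
      have "(\<forall>x\<in>Y. (\<Sum>y\<in>nbrs Y Q x. f y) = 0) \<longleftrightarrow> (\<forall>x\<in>V. (\<Sum>y\<in>nbrs V R x. f (h y)) = 0)"
        unfolding all using sum_nbrs_graph_iso[OF iso, of _ f] by auto
      also have "\<dots> \<longleftrightarrow> (\<exists>c. \<forall>x\<in>V. f (h x) = c * \<nu> x)" by (rule ker)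
      also have "\<dots> \<longleftrightarrow> (\<exists>c. \<forall>x\<in>Y. f x = c * \<nu> (k x))" unfolding all using kh by auto
      finally show ?thesis .
    qed
  qed (use fin in auto)
qed

section \<open>Gluing two tensor products\<close>

text \<open>If the product operator maps \<open>f\<close> to a function that depends on the first coordinate only, then
  replacing \<open>f\<close> by its averages over the fibres does not change the image. By injectivity \<open>f\<close> equals
  its averages, and summing over a fibre leaves an equation for the fibre sums.\<close>

lemma tensor_fibre_constant:
  fixes f :: "'a \<times> 'b \<Rightarrow> real"
  assumes "tensor_factor X R b" "tensor_factor Y Q d" "Y \<noteq> {}"
    and eq: "\<And>x a. \<lbrakk>x \<in> X; a \<in> Y\<rbrakk> \<Longrightarrow> (\<Sum>v\<in>nbrs (X \<times> Y) (tensor R Q) (x, a). f v) = w x"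
  shows sum_fibre: "x \<in> X \<Longrightarrow> real d * (\<Sum>y\<in>nbrs X R x. \<Sum>a\<in>Y. f (y, a)) = real (card Y) * w x"
    and fibre_average: "\<lbrakk>x \<in> X; a \<in> Y\<rbrakk> \<Longrightarrow> f (x, a) = (\<Sum>a\<in>Y. f (x, a)) / real (card Y)"
proof -
  interpret X: tensor_factor X R b by fact
  interpret Y: tensor_factor Y Q d by fact
  interpret XY: tensor_factor "X \<times> Y" "tensor R Q" "b * d"
    by (rule tensor_factor_tensor) fact+
  have card: "real (card Y) \<noteq> 0" using assms(3) Y.fin by simp
  define U where "U x = (\<Sum>a\<in>Y. f (x, a))" for x
  have split: "(\<Sum>v\<in>nbrs (X \<times> Y) (tensor R Q) (x, a). g v) =
      (\<Sum>y\<in>nbrs X R x. \<Sum>c\<in>nbrs Y Q a. g (y, c))" for x a and g :: "'a \<times> 'b \<Rightarrow> real"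
    by (simp add: nbrs_tensor sum.cartesian_product)
  show fib: "real d * (\<Sum>y\<in>nbrs X R x. \<Sum>a\<in>Y. f (y, a)) = real (card Y) * w x" if x: "x \<in> X" for x
  proof -
    have "real (card Y) * w x = (\<Sum>a\<in>Y. \<Sum>y\<in>nbrs X R x. \<Sum>c\<in>nbrs Y Q a. f (y, c))"
      using eq[OF x] by (simp add: split)
    also have "\<dots> = (\<Sum>y\<in>nbrs X R x. \<Sum>a\<in>Y. \<Sum>c\<in>nbrs Y Q a. f (y, c))" by (rule sum.swap)
    also have "\<dots> = real d * (\<Sum>y\<in>nbrs X R x. \<Sum>a\<in>Y. f (y, a))"
      by (simp add: Y.sum_sum_nbrs sum_distrib_left)
    finally show ?thesis by simp
  qed
  show "f (x, a) = (\<Sum>a\<in>Y. f (x, a)) / real (card Y)" if xa: "x \<in> X" "a \<in> Y" for x a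
  proof -
    let ?g = "\<lambda>v. f v - U (fst v) / real (card Y)"
    have "?g (x, a) = 0"
    proof (rule XY.nonsingular[of ?g])
      fix v assume v: "v \<in> X \<times> Y"
      then obtain y c where yc: "v = (y, c)" "y \<in> X" "c \<in> Y" by auto
      have "(\<Sum>z\<in>nbrs X R y. \<Sum>e\<in>nbrs Y Q c. U z / real (card Y)) =
          real d * (\<Sum>z\<in>nbrs X R y. U z) / real (card Y)"
        by (simp add: Y.reg[OF yc(3)] sum_distrib_left sum_divide_distrib)
      also have "\<dots> = w y" using fib[OF yc(2)] card by (simp add: U_def field_simps)
      finally show "(\<Sum>v\<in>nbrs (X \<times> Y) (tensor R Q) v. ?g v) = 0"
        using eq[OF yc(2,3)] by (simp add: yc(1) split sum_subtractf)
    qed (use xa in auto)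
    then show ?thesis by (simp add: U_def)
  qed
qed

text \<open>The data of the construction. The assumption \<open>harmonic\<close> isolates what is needed about \<open>B\<close> and \<open>B'\<close>
  together: the product of their adjacency operators has only the constants as eigenfunctions for the
  largest eigenvalue \<open>b b'\<close>. The assumption \<open>balance\<close> makes the null space nontrivial.\<close>

locale gluing =
  N: tensor_factor N B b + N': tensor_factor N B' b' +
  M: tensor_factor M C d + T: tensor_factor T C' d'
  for N :: "'a set" and B b B' b' and M :: "'c set" and C d and T C' d' +
  assumes nonempty: "N \<noteq> {}" "M \<noteq> {}" "T \<noteq> {}" and disjoint: "M \<inter> T = {}"
    and aut: "graph_iso g N B N B \<Longrightarrow> graph_iso g N B' N B'"
    and arc': "\<lbrakk>x \<in> N; y \<in> N; x' \<in> N; y' \<in> N; B' x y; B' x' y'\<rbrakk>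
      \<Longrightarrow> \<exists>g. graph_iso g N B N B \<and> g x = x' \<and> g y = y'"
    and harmonic: "\<lbrakk>\<And>x. x \<in> N \<Longrightarrow> (\<Sum>y\<in>nbrs N B' x. \<Sum>z\<in>nbrs N B y. u z) = real b * real b' * u x;
        x \<in> N; y \<in> N\<rbrakk> \<Longrightarrow> u x = (u y :: real)"
    and loopless: "\<lbrakk>x \<in> N; a \<in> M\<rbrakk> \<Longrightarrow> \<not> (B x x \<and> C a a)"
      "\<lbrakk>x \<in> N; c \<in> T\<rbrakk> \<Longrightarrow> \<not> (B' x x \<and> C' c c)"
    and balance: "b * d * (b' * d') = card M * card T"
    and degrees: "card T + b * d \<noteq> card M + b' * d'"
begin

definition "adj = (\<lambda>(x, a) (y, c).
  (a \<in> M \<and> c \<in> M \<and> B x y \<and> C a c) \<or> (a \<in> T \<and> c \<in> T \<and> B' x y \<and> C' a c) \<or>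
  (x = y \<and> (a \<in> M \<and> c \<in> T \<or> a \<in> T \<and> c \<in> M)))"

abbreviation "V \<equiv> N \<times> M \<union> N \<times> T"

sublocale NM: tensor_factor "N \<times> M" "tensor B C" "b * d"
  by (intro tensor_factor_tensor N.tensor_factor_axioms M.tensor_factor_axioms)

sublocale NT: tensor_factor "N \<times> T" "tensor B' C'" "b' * d'"
  by (intro tensor_factor_tensor N'.tensor_factor_axioms T.tensor_factor_axioms)

lemma adj_simps:
  shows "\<lbrakk>a \<in> M; c \<in> M\<rbrakk> \<Longrightarrow> adj (x, a) (y, c) \<longleftrightarrow> B x y \<and> C a c"
    and "\<lbrakk>a \<in> T; c \<in> T\<rbrakk> \<Longrightarrow> adj (x, a) (y, c) \<longleftrightarrow> B' x y \<and> C' a c"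
    and "\<lbrakk>a \<in> M; c \<in> T\<rbrakk> \<Longrightarrow> adj (x, a) (y, c) \<longleftrightarrow> x = y"
    and "\<lbrakk>a \<in> T; c \<in> M\<rbrakk> \<Longrightarrow> adj (x, a) (y, c) \<longleftrightarrow> x = y"
  using disjoint by (auto simp: adj_def)

lemma nbrs_adj:
  shows "\<lbrakk>x \<in> N; a \<in> M\<rbrakk> \<Longrightarrow> nbrs V adj (x, a) = nbrs (N \<times> M) (tensor B C) (x, a) \<union> {x} \<times> T"
    and "\<lbrakk>x \<in> N; c \<in> T\<rbrakk> \<Longrightarrow> nbrs V adj (x, c) = nbrs (N \<times> T) (tensor B' C') (x, c) \<union> {x} \<times> M"
proof -
  show "nbrs V adj (x, a) = nbrs (N \<times> M) (tensor B C) (x, a) \<union> {x} \<times> T"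
    if xa: "x \<in> N" "a \<in> M"
  proof (rule Set.set_eqI)
    fix v :: "'a \<times> 'c"
    obtain y c where v: "v = (y, c)" by (cases v)
    have "c \<notin> M \<or> c \<notin> T" using disjoint by blast
    then show "v \<in> nbrs V adj (x, a) \<longleftrightarrow> v \<in> nbrs (N \<times> M) (tensor B C) (x, a) \<union> {x} \<times> T"
      using xa by (cases "c \<in> M"; cases "c \<in> T") (auto simp: v nbrs_def adj_simps)
  qed
  show "nbrs V adj (x, c) = nbrs (N \<times> T) (tensor B' C') (x, c) \<union> {x} \<times> M"
    if xc: "x \<in> N" "c \<in> T"
  proof (rule Set.set_eqI)
    fix v :: "'a \<times> 'c"
    obtain y a where v: "v = (y, a)" by (cases v)
    have "a \<notin> M \<or> a \<notin> T" using disjoint by blast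
    then show "v \<in> nbrs V adj (x, c) \<longleftrightarrow> v \<in> nbrs (N \<times> T) (tensor B' C') (x, c) \<union> {x} \<times> M"
      using xc by (cases "a \<in> M"; cases "a \<in> T") (auto simp: v nbrs_def adj_simps)
  qed
qed

lemma sum_nbrs_adj:
  fixes f :: "'a \<times> 'c \<Rightarrow> 'd::comm_monoid_add"
  shows "\<lbrakk>x \<in> N; a \<in> M\<rbrakk> \<Longrightarrow> (\<Sum>v\<in>nbrs V adj (x, a). f v) =
      (\<Sum>v\<in>nbrs (N \<times> M) (tensor B C) (x, a). f v) + (\<Sum>c\<in>T. f (x, c))"
    and "\<lbrakk>x \<in> N; c \<in> T\<rbrakk> \<Longrightarrow> (\<Sum>v\<in>nbrs V adj (x, c). f v) =
      (\<Sum>v\<in>nbrs (N \<times> T) (tensor B' C') (x, c). f v) + (\<Sum>a\<in>M. f (x, a))"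
proof -
  have fibre: "(\<Sum>v\<in>{x} \<times> A. f v) = (\<Sum>a\<in>A. f (x, a))" for x A
    using sum.cartesian_product[of "\<lambda>y a. f (y, a)" A "{x}"] by simp
  show "(\<Sum>v\<in>nbrs V adj (x, a). f v) =
      (\<Sum>v\<in>nbrs (N \<times> M) (tensor B C) (x, a). f v) + (\<Sum>c\<in>T. f (x, c))"
    if "x \<in> N" "a \<in> M"
    unfolding nbrs_adj(1)[OF that] fibre[symmetric]
  proof (rule sum.union_disjoint)
    show "nbrs (N \<times> M) (tensor B C) (x, a) \<inter> {x} \<times> T = {}"
      using disjoint nbrs_subset[of "N \<times> M" "tensor B C" "(x, a)"] by blast
  qed (use NM.finite_nbrs T.fin in auto)
  show "(\<Sum>v\<in>nbrs V adj (x, c). f v) =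
      (\<Sum>v\<in>nbrs (N \<times> T) (tensor B' C') (x, c). f v) + (\<Sum>a\<in>M. f (x, a))"
    if "x \<in> N" "c \<in> T"
    unfolding nbrs_adj(2)[OF that] fibre[symmetric]
  proof (rule sum.union_disjoint)
    show "nbrs (N \<times> T) (tensor B' C') (x, c) \<inter> {x} \<times> M = {}"
      using disjoint nbrs_subset[of "N \<times> T" "tensor B' C'" "(x, c)"] by blast
  qed (use NT.finite_nbrs M.fin in auto)
qed

lemma card_nbrs_adj:
  shows "\<lbrakk>x \<in> N; a \<in> M\<rbrakk> \<Longrightarrow> card (nbrs V adj (x, a)) = b * d + card T"
    and "\<lbrakk>x \<in> N; c \<in> T\<rbrakk> \<Longrightarrow> card (nbrs V adj (x, c)) = b' * d' + card M"
  using sum_nbrs_adj[where f = "\<lambda>_. 1::nat", of x] NM.reg[of "(x, a)"] NT.reg[of "(x, c)"]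
  by (simp_all flip: card_eq_sum)

text \<open>The ratio of the two values is dictated by the equation at a vertex of \<open>N \<times> M\<close>; the equation at a
  vertex of \<open>N \<times> T\<close> then holds by \<open>balance\<close>.\<close>

definition "\<nu> v = (if snd v \<in> M then 1 else - (real (b * d) / real (card T)))"

lemma \<nu>_simps: "a \<in> M \<Longrightarrow> \<nu> (x, a) = 1" "c \<in> T \<Longrightarrow> \<nu> (x, c) = - (real (b * d) / real (card T))"
  using disjoint by (auto simp: \<nu>_def)

lemma cards_pos: "card M > 0" "card T > 0"
  using nonempty M.fin T.fin by (auto simp: card_gt_0_iff)

lemma real_balance: "real b * real d * (real b' * real d') = real (card M) * real (card T)"
  using balance by (metis of_nat_mult)

lemma kernel_vector:
  assumes f: "\<And>v. v \<in> V \<Longrightarrow> f v = c * \<nu> v" and v: "v \<in> V"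
  shows "(\<Sum>w\<in>nbrs V adj v. f w) = 0"
proof -
  have "(\<Sum>w\<in>nbrs V adj v. f w) = c * (\<Sum>w\<in>nbrs V adj v. \<nu> w)"
    using f nbrs_subset[of V adj v] by (auto simp: sum_distrib_left intro!: sum.cong)
  also have "(\<Sum>w\<in>nbrs V adj v. \<nu> w) = 0"
  proof -
    consider x a where "v = (x, a)" "x \<in> N" "a \<in> M" | x a where "v = (x, a)" "x \<in> N" "a \<in> T"
      using v by auto
    then show ?thesis
    proof cases
      case 1
      have "(\<Sum>w\<in>nbrs (N \<times> M) (tensor B C) (x, a). \<nu> w) = (\<Sum>w\<in>nbrs (N \<times> M) (tensor B C) (x, a). 1)"
        by (rule sum.cong) (auto simp: nbrs_def \<nu>_simps)
      then show ?thesis using 1 cards_pos NM.reg[of "(x, a)"] by (simp add: sum_nbrs_adj \<nu>_simps)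
    next
      case 2
      have "(\<Sum>w\<in>nbrs (N \<times> T) (tensor B' C') (x, a). \<nu> w) =
          (\<Sum>w\<in>nbrs (N \<times> T) (tensor B' C') (x, a). - (real (b * d) / real (card T)))"
        by (rule sum.cong) (auto simp: nbrs_def \<nu>_simps)
      also have "\<dots> = - real (card M)"
        using 2 cards_pos NT.reg[of "(x, a)"] real_balance by (simp add: field_simps)
      finally show ?thesis using 2 by (simp add: sum_nbrs_adj \<nu>_simps)
    qed
  qed
  finally show ?thesis by simp
qed

text \<open>The two conclusions of the lemma on tensor products, applied to both halves, reduce the equations to
  the fibre sums \<open>U\<close> and \<open>W\<close>; eliminating \<open>W\<close> makes \<open>harmonic\<close> applicable to \<open>U\<close>.\<close>

lemma kernel_unique:
  assumes zero: "\<And>v. v \<in> V \<Longrightarrow> (\<Sum>w\<in>nbrs V adj v. f w) = 0"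
  shows "\<exists>c. \<forall>v\<in>V. f v = c * \<nu> v"
proof -
  define U where "U x = (\<Sum>a\<in>M. f (x, a))" for x
  define W where "W x = (\<Sum>c\<in>T. f (x, c))" for x
  note factors = N.tensor_factor_axioms N'.tensor_factor_axioms M.tensor_factor_axioms
    T.tensor_factor_axioms
  have eqM: "(\<Sum>v\<in>nbrs (N \<times> M) (tensor B C) (x, a). f v) = - W x" if "x \<in> N" "a \<in> M" for x a
    using zero[of "(x, a)"] sum_nbrs_adj(1)[OF that, of f] that by (simp add: W_def)
  have eqT: "(\<Sum>v\<in>nbrs (N \<times> T) (tensor B' C') (x, c). f v) = - U x" if "x \<in> N" "c \<in> T" for x c
    using zero[of "(x, c)"] sum_nbrs_adj(2)[OF that, of f] that by (simp add: U_def)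
  have fM: "f (x, a) = U x / real (card M)" if "x \<in> N" "a \<in> M" for x a
    using fibre_average[OF factors(1,3) nonempty(2) eqM that] by (simp add: U_def)
  have fT: "f (x, c) = W x / real (card T)" if "x \<in> N" "c \<in> T" for x c
    using fibre_average[OF factors(2,4) nonempty(3) eqT that] by (simp add: W_def)
  have W: "W x = - (real d / real (card M)) * (\<Sum>y\<in>nbrs N B x. U y)" if "x \<in> N" for x
    using sum_fibre[OF factors(1,3) nonempty(2) eqM that] cards_pos by (simp add: U_def field_simps)
  have U: "real d' * (\<Sum>y\<in>nbrs N B' x. W y) = - real (card T) * U x" if "x \<in> N" for x
    using sum_fibre[OF factors(2,4) nonempty(3) eqT that] by (simp add: W_def)
  obtain x0 where x0: "x0 \<in> N" using nonempty by auto
  have const: "U x = U x0" if "x \<in> N" for x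
  proof (rule harmonic[OF _ that x0])
    fix x assume x: "x \<in> N"
    let ?S = "\<Sum>y\<in>nbrs N B' x. \<Sum>z\<in>nbrs N B y. U z"
    have "(\<Sum>y\<in>nbrs N B' x. W y) = (\<Sum>y\<in>nbrs N B' x. - (real d / real (card M)) * (\<Sum>z\<in>nbrs N B y. U z))"
      using nbrs_subset[of N B' x] by (intro sum.cong refl W) auto
    also have "\<dots> = - (real d / real (card M)) * ?S" by (rule sum_distrib_left[symmetric])
    finally have "real (card M) * (\<Sum>y\<in>nbrs N B' x. W y) = - real d * ?S"
      using cards_pos by (simp add: field_simps)
    then have "real d * real d' * ?S = - real d' * (real (card M) * (\<Sum>y\<in>nbrs N B' x. W y))"
      by simp
    also have "\<dots> = - real (card M) * (real d' * (\<Sum>y\<in>nbrs N B' x. W y))" by simp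
    also have "\<dots> = real (card M) * real (card T) * U x" by (simp only: U[OF x])
    also have "\<dots> = real d * real d' * (real b * real b' * U x)"
      by (simp only: real_balance[symmetric]) simp
    finally show "?S = real b * real b' * U x" using M.pos T.pos by simp
  qed
  have WW: "W x = - (real d / real (card M)) * (real b * U x0)" if "x \<in> N" for x
  proof -
    have "(\<Sum>y\<in>nbrs N B x. U y) = (\<Sum>y\<in>nbrs N B x. U x0)"
      using nbrs_subset[of N B x] by (intro sum.cong refl const) auto
    then show ?thesis using W[OF that] N.reg[OF that] by simp
  qed
  have "f v = U x0 / real (card M) * \<nu> v" if "v \<in> V" for v
    using that fM fT const WW by (auto simp: \<nu>_simps ac_simps)
  then show ?thesis by blast
qed

lemma graph_iso_adj:
  assumes g: "graph_iso g N B N B" and h: "graph_iso h M C M C" and k: "graph_iso k T C' T C'"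
  shows "graph_iso (\<lambda>(x, a). (g x, if a \<in> M then h a else k a)) V adj V adj"
proof -
  let ?\<phi> = "\<lambda>a. if a \<in> M then h a else k a"
  have hM: "h a \<in> M" "h a \<notin> T" if "a \<in> M" for a using graph_iso_mem[OF h that] disjoint by auto
  have kT: "k a \<in> T" "k a \<notin> M" "a \<notin> M" if "a \<in> T" for a
    using graph_iso_mem[OF k that] that disjoint by auto
  have "bij_betw ?\<phi> M M" using graph_iso_bij[OF h] by (simp cong: bij_betw_cong)
  moreover have "bij_betw ?\<phi> T T" using graph_iso_bij[OF k] kT(3) by (simp cong: bij_betw_cong)
  ultimately have "bij_betw ?\<phi> (M \<union> T) (M \<union> T)" using disjoint by (rule bij_betw_combine)
  then have "bij_betw (map_prod g ?\<phi>) (N \<times> (M \<union> T)) (N \<times> (M \<union> T))"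
    using graph_iso_bij[OF g] by (intro bij_betw_map_prod)
  moreover have "map_prod g ?\<phi> = (\<lambda>(x, a). (g x, ?\<phi> a))" by (auto simp: map_prod_def)
  ultimately have "bij_betw (\<lambda>(x, a). (g x, ?\<phi> a)) V V" by (simp add: Sigma_Un_distrib2)
  moreover have "adj (g x, ?\<phi> a) (g y, ?\<phi> c) \<longleftrightarrow> adj (x, a) (y, c)"
    if "x \<in> N" "y \<in> N" "a \<in> M \<union> T" "c \<in> M \<union> T" for x y a c
  proof -
    have inj: "g x = g y \<longleftrightarrow> x = y"
      using that graph_iso_bij[OF g] by (auto simp: bij_betw_def inj_on_eq_iff)
    note rel = graph_iso_rel[OF g] graph_iso_rel[OF aut[OF g]] graph_iso_rel[OF h] graph_iso_rel[OF k]
    consider "a \<in> M" "c \<in> M" | "a \<in> T" "c \<in> T" | "a \<in> M" "c \<in> T" | "a \<in> T" "c \<in> M"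
      using \<open>a \<in> M \<union> T\<close> \<open>c \<in> M \<union> T\<close> by auto
    then show ?thesis
      by cases (simp_all add: adj_simps hM kT inj rel \<open>x \<in> N\<close> \<open>y \<in> N\<close>)
  qed
  ultimately show ?thesis unfolding graph_iso_def by auto
qed

text \<open>Arcs inside a half are moved by arc-transitivity of the two factors. For arcs between the halves
  the first coordinate is constant, and vertex-transitivity of the three graphs suffices.\<close>

lemma arcs_adj:
  assumes PQ: "(P, Q) \<in> {(N \<times> M, N \<times> M), (N \<times> T, N \<times> T), (N \<times> M, N \<times> T)}"
    and uv: "u \<in> P" "v \<in> Q" "u' \<in> P" "v' \<in> Q" "adj u v" "adj u' v'"
  shows "\<exists>g. graph_iso g V adj V adj \<and> g u = u' \<and> g v = v'"
proof -
  obtain x a y c x' a' y' c' where eq: "u = (x, a)" "v = (y, c)" "u' = (x', a')" "v' = (y', c')"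
    by (metis surj_pair)
  have "\<exists>g h k. graph_iso g N B N B \<and> graph_iso h M C M C \<and> graph_iso k T C' T C' \<and>
      g x = x' \<and> g y = y' \<and> (if a \<in> M then h a else k a) = a' \<and> (if c \<in> M then h c else k c) = c'"
  proof -
    consider "P = N \<times> M" "Q = N \<times> M" | "P = N \<times> T" "Q = N \<times> T" | "P = N \<times> M" "Q = N \<times> T"
      using PQ by auto
    then show ?thesis
    proof cases
      case 1
      then have "x \<in> N" "y \<in> N" "x' \<in> N" "y' \<in> N" "a \<in> M" "c \<in> M" "a' \<in> M" "c' \<in> M"
        and "B x y" "C a c" "B x' y'" "C a' c'"
        using uv disjoint by (auto simp: eq adj_def)
      then show ?thesis
        using N.arc[of x y x' y'] M.arc[of a c a' c'] graph_iso_id[of T C'] by auto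
    next
      case 2
      then have "x \<in> N" "y \<in> N" "x' \<in> N" "y' \<in> N" "a \<in> T" "c \<in> T" "a' \<in> T" "c' \<in> T"
        and "B' x y" "C' a c" "B' x' y'" "C' a' c'" "a \<notin> M" "c \<notin> M"
        using uv disjoint by (auto simp: eq adj_def)
      then show ?thesis
        using arc'[of x y x' y'] T.arc[of a c a' c'] graph_iso_id[of M C] by auto
    next
      case 3
      then have *: "x \<in> N" "x' \<in> N" "y = x" "y' = x'" "a \<in> M" "c \<in> T" "a' \<in> M" "c' \<in> T" "c \<notin> M"
        using uv disjoint by (auto simp: eq adj_def)
      obtain g where "graph_iso g N B N B" "g x = x'" using N.vertex_transitive * by metis
      moreover obtain h where "graph_iso h M C M C" "h a = a'" using M.vertex_transitive * by metis
      moreover obtain k where "graph_iso k T C' T C'" "k c = c'" using T.vertex_transitive * by metis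
      ultimately show ?thesis using * by auto
    qed
  qed
  then obtain g h k where ghk: "graph_iso g N B N B" "graph_iso h M C M C" "graph_iso k T C' T C'"
    "g x = x'" "g y = y'" "(if a \<in> M then h a else k a) = a'" "(if c \<in> M then h c else k c) = c'"
    by blast
  show ?thesis
    using graph_iso_adj[OF ghk(1-3)] ghk(4-7)
    by (intro exI[of _ "\<lambda>(x, a). (g x, if a \<in> M then h a else k a)"]) (simp add: eq)
qed

lemma two_orbit_nut: "two_orbit_nut (N \<times> M) (N \<times> T) adj \<nu>"
proof
  show "adj v u" if uv: "u \<in> V" "v \<in> V" "adj u v" for u v
  proof -
    obtain x a y c where eq: "u = (x, a)" "v = (y, c)" by (metis surj_pair)
    have xy: "x \<in> N" "y \<in> N" "a \<in> M \<union> T" "c \<in> M \<union> T" using uv by (auto simp: eq)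
    note syms = N.sym[OF xy(1,2)] N'.sym[OF xy(1,2)] M.sym[of a c] T.sym[of a c]
    consider "a \<in> M" "c \<in> M" | "a \<in> T" "c \<in> T" | "a \<in> M" "c \<in> T" | "a \<in> T" "c \<in> M"
      using xy by blast
    then show ?thesis using uv(3) syms by cases (simp_all add: eq adj_simps)
  qed
  show "\<not> adj v v" if "v \<in> V" for v using that loopless disjoint by (auto simp: adj_def)
  show "card (nbrs V adj u) \<noteq> card (nbrs V adj v)" if "u \<in> N \<times> M" "v \<in> N \<times> T" for u v
    using that degrees by (auto simp: card_nbrs_adj)
  show "\<exists>v\<in>N \<times> T. adj u v" if "u \<in> N \<times> M" for u
    using that nonempty(3) by (auto simp: adj_def)
  show "\<exists>u\<in>N \<times> M. adj u v" if "v \<in> N \<times> T" for v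
    using that nonempty(2) by (auto simp: adj_def)
  obtain x a c where xac: "x \<in> N" "a \<in> M" "c \<in> T" using nonempty by auto
  obtain y where y: "y \<in> N" "B x y" using N.ex_nbr xac by metis
  obtain y' where y': "y' \<in> N" "B' x y'" using N'.ex_nbr xac by metis
  obtain a' where a': "a' \<in> M" "C a a'" using M.ex_nbr xac by metis
  obtain c' where c': "c' \<in> T" "C' c c'" using T.ex_nbr xac by metis
  show "\<exists>u\<in>N \<times> M. \<exists>v\<in>N \<times> M. adj u v"
    using xac y a' by (intro bexI[of _ "(x, a)"] bexI[of _ "(y, a')"]) (auto simp: adj_def)
  show "\<exists>u\<in>N \<times> T. \<exists>v\<in>N \<times> T. adj u v"
    using xac y' c' by (intro bexI[of _ "(x, c)"] bexI[of _ "(y', c')"]) (auto simp: adj_def)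
  show "\<nu> v \<noteq> 0" if "v \<in> V" for v
    using that cards_pos N.pos M.pos by (auto simp: \<nu>_simps)
  show "(\<forall>v\<in>V. (\<Sum>w\<in>nbrs V adj v. f w) = 0) \<longleftrightarrow> (\<exists>c. \<forall>v\<in>V. f v = c * \<nu> v)" for f
    using kernel_unique[of f] kernel_vector[of f] by blast
  show "\<exists>g. graph_iso g V adj V adj \<and> g u = u' \<and> g v = v'"
    if "(P, Q) \<in> {(N \<times> M, N \<times> M), (N \<times> T, N \<times> T), (N \<times> M, N \<times> T)}"
      "u \<in> P" "v \<in> Q" "u' \<in> P" "v' \<in> Q" "adj u v" "adj u' v'" for P Q u v u' v'
    using that by (rule arcs_adj)
qed (use N.fin M.fin T.fin disjoint in auto)

end

section \<open>Existence\<close>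

definition nut_2_3_order :: "nat \<Rightarrow> bool" where
  "nut_2_3_order k \<longleftrightarrow> (\<exists>(V :: nat set) E. nut_graph V E \<and> num_vertex_orbits V E = 2 \<and>
     num_edge_orbits V E = 3 \<and> card V = k)"

lemma two_orbit_nut_order:
  assumes "two_orbit_nut X1 X2 R \<nu>"
  shows "nut_2_3_order (card X1 + card X2)"
proof -
  interpret X: two_orbit_nut X1 X2 R \<nu> by fact
  have "finite (X1 \<union> X2)" using X.fin by simp
  then obtain h :: "'a \<Rightarrow> nat" and Q where iso: "graph_iso h (X1 \<union> X2) R {..<card (X1 \<union> X2)} Q"
    by (rule ex_nat_copy)
  interpret Y: two_orbit_nut "h ` X1" "h ` X2" Q "\<lambda>y. \<nu> (inv_into (X1 \<union> X2) h y)"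
    by (rule two_orbit_nut_graph_iso) fact+
  have "card (h ` X1 \<union> h ` X2) = card X1 + card X2"
    using graph_iso_bij[OF iso] X.fin X.disj
    by (simp add: bij_betw_def image_Un[symmetric] card_Un_disjoint)
  then show ?thesis
    unfolding nut_2_3_order_def using Y.nut Y.num_vertex_orbits Y.num_edge_orbits by blast
qed

text \<open>Loops of the product of \<open>B'\<close> and \<open>C'\<close> have to be excluded. If \<open>\<kappa> = 16\<close> this follows from \<open>B' = B\<close>;
  if \<open>\<kappa> = 4\<close>, then \<open>B'\<close> consists of loops and \<open>C'\<close> must not have any.\<close>

lemma nut_2_3_order_factors:
  assumes B: "base_factor n B" "n > 0" and m: "factor_order False m d" "m > 0"
    and t: "factor_order (\<kappa> = 4) t d'" "t > 0" and \<kappa>: "\<kappa> \<in> {4, 16}"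
    and balance: "\<kappa> * d * d' = m * t" and degrees: "t + 4 * d \<noteq> m + \<kappa> div 4 * d'"
  shows "nut_2_3_order (n * (m + t))"
proof -
  interpret N: tensor_factor "{..<n}" B 4 using B by (simp add: base_factor_def)
  have conn: "two_step_connected {..<n} B" and irrefl: "\<And>x. x < n \<Longrightarrow> \<not> B x x"
    using B by (auto simp: base_factor_def)
  obtain C where C: "tensor_factor {..<m} C d" using m(1) by (auto simp: factor_order_def)
  obtain C0 where C0: "tensor_factor {..<t} C0 d'" "\<kappa> = 4 \<Longrightarrow> \<forall>x<t. \<not> C0 x x"
    using t(1) by (auto simp: factor_order_def)
  have "bij_betw (\<lambda>c. c + m) {..<t} {m..<m + t}"
    by (intro bij_betw_byWitness[where f' = "\<lambda>c. c - m"]) auto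
  note iso = graph_iso_copy[OF this, of C0]
  \<comment> \<open>The second fibre is shifted by \<open>m\<close> to make it disjoint from the first one.\<close>
  define C' where "C' = (\<lambda>u v. C0 (inv_into {..<t} (\<lambda>c. c + m) u) (inv_into {..<t} (\<lambda>c. c + m) v))"
  have C': "tensor_factor {m..<m + t} C' d'"
    unfolding C'_def by (rule tensor_factor_graph_iso[OF C0(1) iso])
  have C'_loopless: "\<not> C' c c" if "\<kappa> = 4" "c \<in> {m..<m + t}" for c
    using graph_iso_loopless[OF iso _ that(2)] C0(2) that(1) unfolding C'_def by auto
  define B' where "B' = (if \<kappa> = 16 then B else (=))"
  have B': "tensor_factor {..<n} B' (\<kappa> div 4)"
    using N.tensor_factor_axioms tensor_factor_identity[of "{..<n}"] \<kappa> by (auto simp: B'_def)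
  have "gluing {..<n} B 4 B' (\<kappa> div 4) {..<m} C d {m..<m + t} C' d'"
  proof (intro gluing.intro gluing_axioms.intro)
    show "graph_iso g {..<n} B' {..<n} B'" if "graph_iso g {..<n} B {..<n} B" for g
      using that by (auto simp: B'_def graph_iso_def bij_betw_def inj_on_eq_iff)
    show "\<exists>g. graph_iso g {..<n} B {..<n} B \<and> g x = x' \<and> g y = y'"
      if xy: "x \<in> {..<n}" "y \<in> {..<n}" "x' \<in> {..<n}" "y' \<in> {..<n}" "B' x y" "B' x' y'" for x y x' y'
    proof (cases "\<kappa> = 16")
      case True
      then show ?thesis using xy N.arc by (simp add: B'_def)
    next
      case False
      then have "x = y" "x' = y'" using xy by (auto simp: B'_def)
      then show ?thesis using N.vertex_transitive[of x x'] xy by metis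
    qed
    show "u x = u y"
      if u: "\<And>x. x \<in> {..<n} \<Longrightarrow> (\<Sum>y\<in>nbrs {..<n} B' x. \<Sum>z\<in>nbrs {..<n} B y. u z) =
          real 4 * real (\<kappa> div 4) * u x"
        and xy: "x \<in> {..<n}" "y \<in> {..<n}" for u :: "nat \<Rightarrow> real" and x y
    proof (rule N.two_step_eigenfunction_constant[OF conn _ xy])
      fix x assume x: "x \<in> {..<n}"
      show "(\<Sum>y\<in>nbrs {..<n} B x. \<Sum>z\<in>nbrs {..<n} B y. u z) = real 4 * real 4 * u x"
      proof (cases "\<kappa> = 16")
        case True
        then show ?thesis using u[OF x] by (simp add: B'_def)
      next
        case False
        \<comment> \<open>Here \<open>B'\<close> is the identity, and an eigenfunction of \<open>B\<close> for 4 is one of \<open>B\<close> squared for 16.\<close>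
        have "(\<Sum>z\<in>nbrs {..<n} B y. u z) = 4 * u y" if "y \<in> {..<n}" for y
        proof -
          have "nbrs {..<n} (=) y = {y}" using that by (auto simp: nbrs_def)
          then show ?thesis using u[OF that] \<kappa> False by (simp add: B'_def)
        qed
        then have "(\<Sum>y\<in>nbrs {..<n} B x. \<Sum>z\<in>nbrs {..<n} B y. u z) = (\<Sum>y\<in>nbrs {..<n} B x. 4 * u y)"
          using nbrs_subset[of "{..<n}" B x] by (intro sum.cong refl) auto
        also have "\<dots> = 4 * (4 * u x)"
          using \<open>\<And>y. y \<in> {..<n} \<Longrightarrow> (\<Sum>z\<in>nbrs {..<n} B y. u z) = 4 * u y\<close> x
          by (simp add: sum_distrib_left[symmetric])
        finally show ?thesis by simp
      qed
    qed
    show "\<not> (B' x x \<and> C' c c)" if "x \<in> {..<n}" "c \<in> {m..<m + t}" for x c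
      using that irrefl C'_loopless[of c] \<kappa> by (auto simp: B'_def)
    show "4 * d * (\<kappa> div 4 * d') = card {..<m} * card {m..<m + t}"
      using balance \<kappa> by auto
    show "card {m..<m + t} + 4 * d \<noteq> card {..<m} + \<kappa> div 4 * d'" using degrees by simp
  qed (use B m t irrefl N.tensor_factor_axioms C C' B' in auto)
  then interpret G: gluing "{..<n}" B 4 B' "\<kappa> div 4" "{..<m}" C d "{m..<m + t}" C' d' .
  show ?thesis
    using two_orbit_nut_order[OF G.two_orbit_nut] by (simp add: card_cartesian_product distrib_left)
qed

text \<open>A perfect matching, as the product of an edge and an identity relation.\<close>

lemma factor_order_even_matching:
  assumes "even t"
  shows "factor_order True t 1"
proof -
  have "factor_order (True \<or> False) (2 * (t div 2)) (1 * 1)"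
    using factor_order_complete[of 2] by (intro factor_order_mult factor_order_identity) simp
  then show ?thesis using assms by simp
qed

lemma factor_order_parameters:
  fixes r q :: nat
  assumes "\<forall>i\<in>{1..r}. prime (p i) \<and> odd (p i)" "\<forall>i\<in>{1..r}. even (d i) \<and> d i dvd p i - 1"
    and "\<forall>i\<in>{1..q}. k i \<ge> 2"
  shows "factor_order (r > 0 \<or> q > 0) (k0 * (\<Prod>i=1..r. p i) * (\<Prod>i=1..q. k i))
    ((\<Prod>i=1..r. d i) * (\<Prod>i=1..q. k i - 1))"
proof -
  have "factor_order ((False \<or> r > 0) \<or> q > 0) (k0 * (\<Prod>i=1..r. p i) * (\<Prod>i=1..q. k i))
    (1 * (\<Prod>i=1..r. d i) * (\<Prod>i=1..q. k i - 1))"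
  proof (intro factor_order_mult)
    show "factor_order False k0 1" by (rule factor_order_identity)
    show "factor_order (r > 0) (\<Prod>i=1..r. p i) (\<Prod>i=1..r. d i)"
      using assms by (intro factor_order_prod factor_order_prime) blast+
    show "factor_order (q > 0) (\<Prod>i=1..q. k i) (\<Prod>i=1..q. k i - 1)"
      using assms by (intro factor_order_prod factor_order_complete) blast
  qed
  then show ?thesis by simp
qed

theorem corollary4p4:
  fixes n :: nat
  assumes "n \<ge> 5" and "odd n" and "n mod 4 = 1 \<or> \<not> prime n"
  shows
    "(\<forall>(m::nat) (t::nat) (m0::nat) (t0::nat) (r1::nat) (q1::nat) (r2::nat) (q2::nat)
        (mp :: nat \<Rightarrow> nat) (mp' :: nat \<Rightarrow> nat) (tp :: nat \<Rightarrow> nat) (tp' :: nat \<Rightarrow> nat).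
        m \<ge> 1 \<and> odd m \<and> t \<ge> 2 \<and> even t \<and> m0 \<ge> 1 \<and> t0 \<ge> 1 \<and>
        m = m0 * (\<Prod>i=1..r1. mp i) * (\<Prod>i=1..q1. mp' i) \<and>
        t = t0 * (\<Prod>i=1..r2. tp i) * (\<Prod>i=1..q2. tp' i) \<and>
        (\<forall>i\<in>{1..r1}. prime (mp i) \<and> odd (mp i)) \<and>
        (\<forall>i\<in>{1..r2}. prime (tp i) \<and> odd (tp i)) \<and>
        (\<forall>i\<in>{1..q1}. mp' i \<ge> 2) \<and>
        (\<forall>i\<in>{1..q2}. tp' i \<ge> 2) \<and>
        (\<exists>(d :: nat \<Rightarrow> nat) (d' :: nat \<Rightarrow> nat) (\<kappa>::nat).
           (\<forall>i\<in>{1..r1}. even (d i) \<and> d i dvd mp i - 1) \<and>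
           (\<forall>j\<in>{1..r2}. even (d' j) \<and> d' j dvd tp j - 1) \<and>
           \<kappa> \<in> {4, 16} \<and>
           \<kappa> * (\<Prod>i=1..r1. d i) * (\<Prod>j=1..r2. d' j)
             * (\<Prod>i=1..q1. (mp' i - 1)) * (\<Prod>i=1..q2. (tp' i - 1)) = m * t \<and>
           t + 4 * (\<Prod>i=1..r1. d i) * (\<Prod>i=1..q1. (mp' i - 1))
             \<noteq> m + (\<kappa> div 4) * (\<Prod>j=1..r2. d' j) * (\<Prod>i=1..q2. (tp' i - 1)))
        \<longrightarrow> (\<exists>(V :: nat set) E. nut_graph V E \<and> num_vertex_orbits V E = 2 \<and>
               num_edge_orbits V E = 3 \<and> card V = n * (m + t)))
     \<and> (\<forall>s \<in> {17, 19, 23, 73, 79, 97, 107, 113}.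
          \<exists>(V :: nat set) E. nut_graph V E \<and> num_vertex_orbits V E = 2 \<and>
            num_edge_orbits V E = 3 \<and> card V = n * s)"
  unfolding nut_2_3_order_def[symmetric]
proof (intro conjI allI impI)
  obtain B where B: "base_factor n B" using ex_base_factor[OF assms] by blast
  have n: "n > 0" using assms by simp
  {
    fix m t m0 t0 r1 q1 r2 q2 :: nat and mp mp' tp tp' :: "nat \<Rightarrow> nat"
    assume H: "m \<ge> 1 \<and> odd m \<and> t \<ge> 2 \<and> even t \<and> m0 \<ge> 1 \<and> t0 \<ge> 1 \<and>
        m = m0 * (\<Prod>i=1..r1. mp i) * (\<Prod>i=1..q1. mp' i) \<and>
        t = t0 * (\<Prod>i=1..r2. tp i) * (\<Prod>i=1..q2. tp' i) \<and>
        (\<forall>i\<in>{1..r1}. prime (mp i) \<and> odd (mp i)) \<and>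
        (\<forall>i\<in>{1..r2}. prime (tp i) \<and> odd (tp i)) \<and>
        (\<forall>i\<in>{1..q1}. mp' i \<ge> 2) \<and>
        (\<forall>i\<in>{1..q2}. tp' i \<ge> 2) \<and>
        (\<exists>(d :: nat \<Rightarrow> nat) (d' :: nat \<Rightarrow> nat) (\<kappa>::nat).
           (\<forall>i\<in>{1..r1}. even (d i) \<and> d i dvd mp i - 1) \<and>
           (\<forall>j\<in>{1..r2}. even (d' j) \<and> d' j dvd tp j - 1) \<and>
           \<kappa> \<in> {4, 16} \<and>
           \<kappa> * (\<Prod>i=1..r1. d i) * (\<Prod>j=1..r2. d' j)
             * (\<Prod>i=1..q1. (mp' i - 1)) * (\<Prod>i=1..q2. (tp' i - 1)) = m * t \<and>
           t + 4 * (\<Prod>i=1..r1. d i) * (\<Prod>i=1..q1. (mp' i - 1))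
             \<noteq> m + (\<kappa> div 4) * (\<Prod>j=1..r2. d' j) * (\<Prod>i=1..q2. (tp' i - 1)))"
    then obtain d d' \<kappa> where
      d: "\<forall>i\<in>{1..r1}. even (d i) \<and> d i dvd mp i - 1" and
      d': "\<forall>j\<in>{1..r2}. even (d' j) \<and> d' j dvd tp j - 1" and
      \<kappa>: "\<kappa> \<in> {4, 16}" and
      balance: "\<kappa> * (\<Prod>i=1..r1. d i) * (\<Prod>j=1..r2. d' j)
             * (\<Prod>i=1..q1. (mp' i - 1)) * (\<Prod>i=1..q2. (tp' i - 1)) = m * t" and
      degrees: "t + 4 * (\<Prod>i=1..r1. d i) * (\<Prod>i=1..q1. (mp' i - 1))
             \<noteq> m + (\<kappa> div 4) * (\<Prod>j=1..r2. d' j) * (\<Prod>i=1..q2. (tp' i - 1))"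
      by blast
    let ?D = "(\<Prod>i=1..r1. d i) * (\<Prod>i=1..q1. mp' i - 1)"
    let ?D' = "(\<Prod>j=1..r2. d' j) * (\<Prod>i=1..q2. tp' i - 1)"
    have facm: "factor_order (r1 > 0 \<or> q1 > 0) m ?D"
      using factor_order_parameters[of r1 mp d q1 mp' m0] H d by simp
    have fact: "factor_order (r2 > 0 \<or> q2 > 0) t ?D'"
      using factor_order_parameters[of r2 tp d' q2 tp' t0] H d' by simp
    have fact': "factor_order True t ?D'"
    proof (cases "r2 > 0 \<or> q2 > 0")
      case True
      then show ?thesis using fact by simp
    next
      \<comment> \<open>Without any factor that excludes loops, \<open>t = t0\<close> and \<open>?D' = 1\<close>; a matching needs \<open>t\<close> even.\<close>
      case False
      have "even t" using H by blast
      with False show ?thesis using factor_order_even_matching[of t] by simp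
    qed
    have "m \<ge> 1" "t \<ge> 2" using H by blast+
    show "nut_2_3_order (n * (m + t))"
    proof (rule nut_2_3_order_factors[OF B n factor_order_mono[OF facm] _
          factor_order_mono[OF fact'] _ \<kappa>])
      show "\<kappa> * ?D * ?D' = m * t" using balance by (simp add: ac_simps)
      show "t + 4 * ?D \<noteq> m + \<kappa> div 4 * ?D'" using degrees by (simp add: ac_simps)
    qed (use \<open>m \<ge> 1\<close> \<open>t \<ge> 2\<close> in auto)
  }
  show "\<forall>s\<in>{17, 19, 23, 73, 79, 97, 107, 113}. nut_2_3_order (n * s)"
  proof -
    have mult: "factor_order False (k * k') (e * e')"
      if "factor_order False k e" "factor_order False k' e'" for k k' e e'
      using factor_order_mult[OF that] by simp
    have K: "factor_order False k (k - 1)" if "k \<ge> 2" for k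
      using factor_order_complete[OF that] by (rule factor_order_mono) simp
    have K2: "factor_order False 2 1" and K3: "factor_order False 3 2" and K4: "factor_order False 4 3"
      and K8: "factor_order False 8 7" and K12: "factor_order False 12 11" and K16: "factor_order False 16 15"
      using K[of 2] K[of 3] K[of 4] K[of 8] K[of 12] K[of 16] by simp_all
    have P: "factor_order False p 2" if "prime p" "odd p" for p
      by (rule factor_order_mono[OF factor_order_prime[of p 2]]) (use that in simp_all)
    have P5: "factor_order False 5 2" and P11: "factor_order False 11 2"
      using P[of 5] P[of 11] by simp_all
    note I = factor_order_identity
    have glue: "nut_2_3_order (n * s)"
      if "factor_order False m e" "factor_order False t e'" "m > 0" "t > 0" "16 * e * e' = m * t"
        "t + 4 * e \<noteq> m + 4 * e'" "s = m + t" for m t e e' s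
      using nut_2_3_order_factors[OF B n that(1,3) _ that(4), of 16 e'] that by simp
    \<comment> \<open>For \<open>\<kappa> = 16\<close>, each line gives a splitting \<open>s = m + t\<close> together with factorizations
      of \<open>m\<close> and \<open>t\<close> whose degrees \<open>e\<close> and \<open>e'\<close> satisfy \<open>16 e e' = m t\<close>.\<close>
    have "nut_2_3_order (n * 17)" by (rule glue[OF I[of 1] I[of 16]]) simp_all
    moreover have "nut_2_3_order (n * 19)"
      by (rule glue[OF I[of 3] mult[OF K2 mult[OF K2 K4]]]) simp_all
    moreover have "nut_2_3_order (n * 23)"
      by (rule glue[OF I[of 7] mult[OF K2 K8]]) simp_all
    moreover have "nut_2_3_order (n * 73)"
      by (rule glue[OF mult[OF K3 K3] mult[OF mult[OF K2 K2] mult[OF K4 K4]]]) simp_all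
    moreover have "nut_2_3_order (n * 79)"
      by (rule glue[OF mult[OF K3 P5] mult[OF mult[OF K2 K2] K16]]) simp_all
    moreover have "nut_2_3_order (n * 97)"
      by (rule glue[OF I[of 1] mult[OF mult[OF K2 mult[OF K2 K2]] mult[OF K3 K4]]]) simp_all
    moreover have "nut_2_3_order (n * 107)"
      by (rule glue[OF P11 mult[OF K2 mult[OF K4 K12]]]) simp_all
    moreover have "nut_2_3_order (n * 113)"
      by (rule glue[OF I[of 1] mult[OF I[of 7] mult[OF K2 K8]]]) simp_all
    ultimately show ?thesis by simp
  qed
qed

end
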